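(* Let $m \ge 9$ and $n \ge m^2 - m + 1$ be integers, and let $T_n$ be any tree on $n$ vertices. Then $R(T_n, F_m) = 2n - 1$.
   Context: All graphs are finite and simple. For graphs $H$ and $K$, the Ramsey number $R(H,K)$ is the smallest positive integer $N$ such that for every graph $G$ on $N$ vertices, either $G$ contains $H$ as a subgraph or the complement $\overline{G}$ contains $K$ as a subgraph. The fan $F_m$ is the graph on $2m+1$ vertices consisting of $m$ triangles sharing one common vertex (equivalently, a vertex joined to every vertex of a matching with $m$ edges). *)

theory Defs
  imports Main
begin

type_synonym 'a graph = "'a set \<times> 'a set set"

definition all_edges :: "'a set \<Rightarrow> 'a set set" where
  "all_edges V = {{u, v} | u v. u \<in> V \<and> v \<in> V \<and> u \<noteq> v}"

definition simple_graph :: "'a graph \<Rightarrow> bool" where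
  "simple_graph G \<longleftrightarrow> finite (fst G) \<and> snd G \<subseteq> all_edges (fst G)"

definition complement :: "'a graph \<Rightarrow> 'a graph" where
  "complement G = (fst G, all_edges (fst G) - snd G)"

definition contains :: "'a graph \<Rightarrow> 'b graph \<Rightarrow> bool" where
  "contains G H \<longleftrightarrow> (\<exists>f. inj_on f (fst H) \<and> f ` fst H \<subseteq> fst G \<and>
      (\<forall>e\<in>snd H. f ` e \<in> snd G))"

definition connected_graph :: "'a graph \<Rightarrow> bool" where
  "connected_graph G \<longleftrightarrow>
     (\<forall>u\<in>fst G. \<forall>v\<in>fst G. (\<lambda>x y. {x, y} \<in> snd G)\<^sup>*\<^sup>* u v)"

definition has_cycle :: "'a graph \<Rightarrow> bool" where
  "has_cycle G \<longleftrightarrow> (\<exists>xs. length xs \<ge> 3 \<and> distinct xs \<and> set xs \<subseteq> fst G \<and>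
      (\<forall>i. Suc i < length xs \<longrightarrow> {xs ! i, xs ! Suc i} \<in> snd G) \<and>
      {last xs, hd xs} \<in> snd G)"

definition tree :: "'a graph \<Rightarrow> bool" where
  "tree G \<longleftrightarrow> simple_graph G \<and> fst G \<noteq> {} \<and> connected_graph G \<and> \<not> has_cycle G"

definition fan :: "nat \<Rightarrow> nat graph" where
  "fan m = ({0..2*m},
            {{0, i} | i. 1 \<le> i \<and> i \<le> 2*m} \<union> {{2*i - 1, 2*i} | i. 1 \<le> i \<and> i \<le> m})"

text \<open>Ramsey number: least positive N such that every graph on N vertices
  (w.l.o.g. vertex set {..<N}) contains H or its complement contains K.\<close>
definition ramsey_number :: "'a graph \<Rightarrow> 'b graph \<Rightarrow> nat" where
  "ramsey_number H K = (LEAST N. N > 0 \<and>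
     (\<forall>E. simple_graph ({..<N}, E) \<longrightarrow>
        contains ({..<N}, E) H \<or> contains (complement ({..<N}, E)) K))"

end

theory Submission
  imports Defs
begin

text \<open>
  Let \<open>k = m - 1\<close>, let \<open>G\<close> have \<open>2n - 1\<close> vertices and suppose that its complement \<open>H\<close> has no \<open>F\<^sub>m\<close>:
  no neighbourhood in \<open>H\<close> has a matching with more than \<open>k\<close> edges. If \<open>G\<close> does not contain \<open>T\<close>, then
  greedy embedding fails, so some vertex has \<open>n\<close> neighbours in \<open>H\<close>, and a Tutte--Berge argument finds
  among them a core: a clique \<open>A\<close> of \<open>G\<close> joined completely to a set \<open>Y\<close>, with
  \<open>card A + card Y = n - b\<close>, \<open>b \<le> k\<close> and \<open>card Y \<le> 3 (k - b)\<close>. To embed \<open>T\<close> it suffices to attach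
  \<open>b\<close> suitable vertices of \<open>T\<close> to \<open>A\<close> from outside. If this is impossible, \<open>G\<close> has so few edges
  between \<open>A\<close> and the outside that \<open>H\<close> is almost complete there, which yields a second core \<open>A'\<close>, \<open>Y'\<close>
  with defect \<open>b'\<close>, and \<open>b + b' - 1\<close> further vertices. A further vertex with many \<open>H\<close>-neighbours in both
  cores is the centre of a fan, so either \<open>b\<close> of them can be attached to the first core or \<open>b'\<close> of them to
  the second one.

  The vertices of \<open>T\<close> to be attached are \<open>k\<close> leaves with a common neighbour; or \<open>k\<close> leaves of which at
  most about half share a neighbour; or, as \<open>T\<close> otherwise has fewer than \<open>3k/2\<close> leaves, \<open>k\<close> vertices of
  degree 2 with disjoint neighbourhoods. In the first case a further vertex may fit to neither core; it then
  has degree at least \<open>n - 1\<close> in \<open>G\<close> and serves as the common neighbour of the leaves.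
\<close>

section \<open>Trees\<close>

text \<open>Trees are used through this growth by single leaves: it gives inductions for paths,
  degree sums, colourings and embeddings.\<close>

inductive built :: "'a set \<Rightarrow> 'a set set \<Rightarrow> bool" where
  single: "built {v} {}"
| add_leaf: "\<lbrakk>built V E; u \<in> V; w \<notin> V\<rbrakk> \<Longrightarrow> built (insert w V) (insert {u, w} E)"

lemma built_finite: "built V E \<Longrightarrow> finite V"
  by (induction rule: built.induct) auto

lemma built_nonempty: "built V E \<Longrightarrow> V \<noteq> {}"
  by (induction rule: built.induct) auto

lemma built_edges: "built V E \<Longrightarrow> e \<in> E \<Longrightarrow> \<exists>x y. e = {x, y} \<and> x \<noteq> y \<and> x \<in> V \<and> y \<in> V"
proof (induction rule: built.induct)
  case (add_leaf V E u w)
  show ?case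
  proof (cases "e = {u, w}")
    case True
    then show ?thesis using add_leaf.hyps by blast
  next
    case False
    then show ?thesis using add_leaf by blast
  qed
qed simp

lemma built_edge_mem:
  assumes "built V E" "{x, y} \<in> E"
  shows "x \<in> V" "y \<in> V" "x \<noteq> y"
proof -
  obtain a b where "{x, y} = {a, b}" "a \<noteq> b" "a \<in> V" "b \<in> V"
    using built_edges[OF assms] by blast
  then show "x \<in> V" "y \<in> V" "x \<noteq> y"
    by (auto simp: doubleton_eq_iff)
qed

section \<open>Paths in grown trees, and growing an arbitrary tree\<close>

definition walk :: "'a set set \<Rightarrow> 'a list \<Rightarrow> bool" where
  "walk E xs \<longleftrightarrow> (\<forall>i. Suc i < length xs \<longrightarrow> {xs ! i, xs ! Suc i} \<in> E)"

lemma walk_mono: "walk E xs \<Longrightarrow> E \<subseteq> F \<Longrightarrow> walk F xs"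
  by (auto simp: walk_def)

lemma walk_Cons: "walk E (y # ys) \<Longrightarrow> ys = [] \<or> {x, y} \<in> E \<Longrightarrow> {x, y} \<in> E \<Longrightarrow> walk E (x # y # ys)"
  by (auto simp: walk_def nth_Cons split: nat.splits)

lemma walk_rev: "walk E xs \<Longrightarrow> walk E (rev xs)"
  unfolding walk_def
proof (intro allI impI)
  fix i assume h: "\<forall>i. Suc i < length xs \<longrightarrow> {xs ! i, xs ! Suc i} \<in> E" and i: "Suc i < length (rev xs)"
  define j where "j = length xs - Suc (Suc i)"
  have "Suc j < length xs" "rev xs ! i = xs ! Suc j" "rev xs ! Suc i = xs ! j"
    using i by (auto simp: j_def rev_nth Suc_diff_Suc)
  then show "{rev xs ! i, rev xs ! Suc i} \<in> E"
    using h by (metis insert_commute)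
qed

text \<open>A path from the new leaf \<open>w\<close> is \<open>w\<close> put before a path from its
  neighbour \<open>u\<close>; the other cases keep an old path or reverse one.\<close>

lemma built_path:
  assumes "built V E" "x \<in> V" "y \<in> V"
  shows "\<exists>xs. xs \<noteq> [] \<and> distinct xs \<and> set xs \<subseteq> V \<and> hd xs = x \<and> last xs = y \<and> walk E xs"
  using assms
proof (induction arbitrary: x y rule: built.induct)
  case (single v)
  then show ?case by (intro exI[of _ "[v]"]) (auto simp: walk_def)
next
  case (add_leaf V E u w)
  let ?P = "\<lambda>x y. \<exists>xs. xs \<noteq> [] \<and> distinct xs \<and> set xs \<subseteq> insert w V \<and> hd xs = x \<and> last xs = y \<and>
    walk (insert {u, w} E) xs"
  have old: "?P x y" if xy: "x \<in> V" "y \<in> V" for x y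
  proof -
    obtain xs where "xs \<noteq> []" "distinct xs" "set xs \<subseteq> V" "hd xs = x" "last xs = y" "walk E xs"
      using add_leaf.IH[OF xy] by blast
    then show ?thesis
      using walk_mono[of E xs "insert {u, w} E"] by (intro exI[of _ xs]) auto
  qed
  have new: "?P w y" if y: "y \<in> V" for y
  proof -
    obtain xs where xs: "xs \<noteq> []" "distinct xs" "set xs \<subseteq> V" "hd xs = u" "last xs = y" "walk E xs"
      using add_leaf.IH[OF add_leaf.hyps(2) y] by blast
    then obtain zs where zs: "xs = u # zs" by (cases xs) auto
    have "walk (insert {u, w} E) (w # u # zs)"
      using walk_mono[OF xs(6)] zs by (intro walk_Cons) (auto simp: insert_commute)
    then show ?thesis
      using xs zs add_leaf.hyps(3) by (intro exI[of _ "w # xs"]) auto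
  qed
  have sym: "?P y x" if xy: "?P x y" for x y
  proof -
    obtain xs where xs: "xs \<noteq> []" "distinct xs" "set xs \<subseteq> insert w V" "hd xs = x" "last xs = y"
      "walk (insert {u, w} E) xs" using xy by blast
    have "rev xs \<noteq> []" "distinct (rev xs)" "set (rev xs) \<subseteq> insert w V" "hd (rev xs) = y" "last (rev xs) = x"
      using xs(1-5) by (simp_all add: hd_rev last_rev)
    then show ?thesis using walk_rev[OF xs(6)] by blast
  qed
  have self: "?P w w" by (intro exI[of _ "[w]"]) (auto simp: walk_def)
  show ?case
  proof (cases "x = w"; cases "y = w")
    assume "x = w" "y = w" then show ?thesis using self by simp
  next
    assume "x = w" "y \<noteq> w" then show ?thesis using new[of y] add_leaf.prems by simp
  next
    assume "x \<noteq> w" "y = w" then show ?thesis using sym[OF new[of x]] add_leaf.prems by simp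
  next
    assume "x \<noteq> w" "y \<noteq> w" then show ?thesis using old[of x y] add_leaf.prems by simp
  qed
qed

text \<open>Take a largest vertex set \<open>S\<close> whose induced subgraph is grown. Were it
  proper, connectedness would give an edge leaving \<open>S\<close>; by acyclicity it is the only
  edge from its outer end into \<open>S\<close>, so \<open>S\<close> could grow by a leaf.\<close>

lemma tree_built:
  assumes "tree T"
  shows "built (fst T) (snd T)"
proof -
  let ?V = "fst T" and ?E = "snd T"
  have fin: "finite ?V" and Esub: "?E \<subseteq> all_edges ?V" and ne: "?V \<noteq> {}"
    and con: "connected_graph T" and acyc: "\<not> has_cycle T"
    using assms by (auto simp: tree_def simple_graph_def)
  define good where "good S \<longleftrightarrow> S \<subseteq> ?V \<and> built S {e \<in> ?E. e \<subseteq> S}" for S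
  obtain v where v: "v \<in> ?V" using ne by blast
  have empty: "{e \<in> ?E. e \<subseteq> {v}} = {}"
    using Esub by (fastforce simp: all_edges_def)
  have "good {v}" unfolding good_def empty using v built.single[of v] by simp
  moreover have "\<forall>S. good S \<longrightarrow> card S < Suc (card ?V)"
    using fin by (auto simp: good_def less_Suc_eq_le card_mono)
  ultimately obtain S where S: "good S" and max: "\<And>S'. good S' \<Longrightarrow> card S' \<le> card S"
    using ex_has_greatest_nat[of good "{v}" card "Suc (card ?V)"] by (metis less_imp_le)
  have finS: "finite S" and SV: "S \<subseteq> ?V" and bS: "built S {e \<in> ?E. e \<subseteq> S}"
    using S fin finite_subset by (auto simp: good_def)
  have "S = ?V"
  proof (rule ccontr)
    assume "S \<noteq> ?V"
    then obtain z where z: "z \<in> ?V" "z \<notin> S" using SV by blast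
    obtain s where s: "s \<in> S" using built_nonempty[OF bS] by blast
    have reach: "(\<lambda>x y. {x, y} \<in> ?E)\<^sup>*\<^sup>* s z"
      using con s z SV by (auto simp: connected_graph_def)
    have "\<exists>u w. u \<in> S \<and> w \<notin> S \<and> {u, w} \<in> ?E"
    proof (rule ccontr)
      assume nex: "\<not> ?thesis"
      have "(\<lambda>x y. {x, y} \<in> ?E)\<^sup>*\<^sup>* a b \<Longrightarrow> a \<in> S \<Longrightarrow> b \<in> S" for a b
        by (induction rule: rtranclp_induct) (use nex in auto)
      then show False using reach s z by blast
    qed
    then obtain u w where uw: "u \<in> S" "w \<notin> S" "{u, w} \<in> ?E" by blast
    have wV: "w \<in> ?V" using uw Esub by (auto simp: all_edges_def doubleton_eq_iff)
    \<comment> \<open>A second edge from \<open>w\<close> into \<open>S\<close> would close a cycle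
      with the path inside \<open>S\<close> that joins the two neighbours.\<close>
    have uniq: "u' = u" if u': "u' \<in> S" "{u', w} \<in> ?E" for u'
    proof (rule ccontr)
      assume neq: "u' \<noteq> u"
      obtain xs where xs: "xs \<noteq> []" "distinct xs" "set xs \<subseteq> S" "hd xs = u" "last xs = u'"
        "walk {e \<in> ?E. e \<subseteq> S} xs"
        using built_path[OF bS uw(1) u'(1)] by blast
      then obtain zs where zs: "xs = u # zs" by (cases xs) auto
      have zs0: "zs \<noteq> []" using xs zs neq by auto
      have "walk ?E (w # u # zs)"
        using walk_mono[OF xs(6), of ?E] zs uw(3) by (intro walk_Cons) (auto simp: insert_commute)
      moreover have "length (w # xs) \<ge> 3" using zs zs0 by (cases zs) auto
      moreover have "distinct (w # xs)" "set (w # xs) \<subseteq> ?V"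
        using xs uw wV SV by auto
      moreover have "{last (w # xs), hd (w # xs)} \<in> ?E" using xs u' by simp
      ultimately have "has_cycle T"
        unfolding has_cycle_def walk_def using zs by blast
      then show False using acyc by blast
    qed
    have "{e \<in> ?E. e \<subseteq> insert w S} = insert {u, w} {e \<in> ?E. e \<subseteq> S}"
    proof (intro equalityI subsetI)
      fix e assume e: "e \<in> {e \<in> ?E. e \<subseteq> insert w S}"
      then obtain a b where ab: "e = {a, b}" "a \<noteq> b" using Esub by (auto simp: all_edges_def)
      consider "a = w" | "b = w" | "a \<noteq> w" "b \<noteq> w" by blast
      then show "e \<in> insert {u, w} {e \<in> ?E. e \<subseteq> S}"
      proof cases
        case 1
        then have "b \<in> S" "{b, w} \<in> ?E" using e ab by (auto simp: insert_commute)
        then have "b = u" by (rule uniq)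
        then show ?thesis using 1 ab by (auto simp: insert_commute)
      next
        case 2
        then have "a \<in> S" "{a, w} \<in> ?E" using e ab by auto
        then have "a = u" by (rule uniq)
        then show ?thesis using 2 ab by auto
      qed (use e ab in auto)
    qed (use uw in auto)
    then have "good (insert w S)"
      using built.add_leaf[OF bS uw(1,2)] wV SV by (simp add: good_def)
    then show False using max[of "insert w S"] uw finS by simp
  qed
  moreover have "{e \<in> ?E. e \<subseteq> ?V} = ?E" using Esub by (auto simp: all_edges_def)
  ultimately show ?thesis using bS by simp
qed

section \<open>Degree sums, two-colourings and greedy embeddings of trees\<close>

lemma built_degree_sum:
  assumes "built V E"
  shows "(\<Sum>x\<in>V. card {y \<in> V. {x, y} \<in> E}) + 2 = 2 * card V"
proof -
  \<comment> \<open>The degree sum is the number of ordered adjacent pairs, and every added leaf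
    contributes exactly two of them.\<close>
  have "card {(x, y). {x, y} \<in> E} + 2 = 2 * card V \<and> finite {(x, y). {x, y} \<in> E}"
    using assms
  proof (induction rule: built.induct)
    case (add_leaf V E u w)
    have eq: "{(x, y). {x, y} \<in> insert {u, w} E} = insert (u, w) (insert (w, u) {(x, y). {x, y} \<in> E})"
      by (auto simp: doubleton_eq_iff)
    have "(u, w) \<notin> insert (w, u) {(x, y). {x, y} \<in> E}" "(w, u) \<notin> {(x, y). {x, y} \<in> E}"
      using add_leaf.hyps built_edge_mem[OF add_leaf.hyps(1)] by auto
    then show ?case
      unfolding eq using add_leaf built_finite[OF add_leaf.hyps(1)] by simp
  qed simp
  moreover have "{(x, y). {x, y} \<in> E} = (SIGMA x:V. {y \<in> V. {x, y} \<in> E})"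
    using built_edge_mem[OF assms] by auto
  ultimately show ?thesis
    using built_finite[OF assms] by simp
qed

text \<open>A new leaf takes the colour opposite to that of its only neighbour. The colouring later
  supplies independent sets and excludes loops.\<close>

lemma built_coloring:
  assumes "built V E"
  shows "\<exists>col :: 'a \<Rightarrow> bool. \<forall>x y. {x, y} \<in> E \<longrightarrow> col x \<noteq> col y"
  using assms
proof (induction rule: built.induct)
  case (add_leaf V E u w)
  then obtain col :: "'a \<Rightarrow> bool" where col: "\<forall>x y. {x, y} \<in> E \<longrightarrow> col x \<noteq> col y" by blast
  let ?c = "col(w := \<not> col u)"
  have "?c x \<noteq> ?c y" if xy: "{x, y} \<in> insert {u, w} E" for x y
  proof (cases "{x, y} = {u, w}")
    case True
    have "u \<noteq> w" using add_leaf.hyps by auto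
    then have "?c u \<noteq> ?c w" by simp
    moreover have "x = u \<and> y = w \<or> x = w \<and> y = u" using True by (simp add: doubleton_eq_iff)
    ultimately show ?thesis by metis
  next
    case False
    then have e: "{x, y} \<in> E" using xy by blast
    then have "x \<noteq> w" "y \<noteq> w" using built_edge_mem[OF add_leaf.hyps(1) e] add_leaf.hyps by auto
    then show ?thesis using col e by simp
  qed
  then show ?case by blast
qed simp

text \<open>Greedy embedding: a new leaf avoids the fewer than \<open>d\<close> vertices used so far.\<close>
lemma built_greedy_embedding:
  assumes "built U F" "card U \<le> Suc d" "finite V" "V \<noteq> {}"
    and deg: "\<And>x. x \<in> V \<Longrightarrow> d \<le> card {y \<in> V. y \<noteq> x \<and> adj x y}"
    and sym: "\<And>x y. adj x y \<Longrightarrow> adj y x"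
  shows "\<exists>f. inj_on f U \<and> f ` U \<subseteq> V \<and> (\<forall>x y. {x, y} \<in> F \<longrightarrow> adj (f x) (f y))"
  using assms(1,2)
proof (induction rule: built.induct)
  case (single v)
  obtain a where "a \<in> V" using assms(4) by blast
  then show ?case by (intro exI[of _ "\<lambda>_. a"]) auto
next
  case (add_leaf U F u w)
  have finU: "finite U" by (rule built_finite[OF add_leaf.hyps(1)])
  have cU: "card U \<le> d" using add_leaf finU by simp
  then obtain f where f: "inj_on f U" "f ` U \<subseteq> V" "\<And>x y. {x, y} \<in> F \<Longrightarrow> adj (f x) (f y)"
    using add_leaf.IH by auto
  let ?N = "{y \<in> V. y \<noteq> f u \<and> adj (f u) y}"
  \<comment> \<open>\<open>f u\<close> itself is no candidate for the new leaf, so at most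
    \<open>card U - 1\<close> candidates are taken.\<close>
  have "card (f ` (U - {u})) < card ?N"
  proof -
    have "card (f ` (U - {u})) \<le> card (U - {u})" using finU by (simp add: card_image_le)
    also have "\<dots> < card U" using finU add_leaf.hyps by (intro psubset_card_mono) auto
    also have "\<dots> \<le> card ?N" using cU deg[of "f u"] f(2) add_leaf.hyps by force
    finally show ?thesis .
  qed
  then have "\<not> ?N \<subseteq> f ` (U - {u})"
    using finU by (meson card_mono finite_Diff finite_imageI not_less)
  then obtain z where z: "z \<in> V" "z \<noteq> f u" "adj (f u) z" "z \<notin> f ` U" by blast
  let ?g = "f(w := z)"
  have "inj_on ?g (insert w U)"
    using inj_on_fun_updI[OF f(1) z(4), of w] z(4) add_leaf.hyps(3) by (auto simp: inj_on_insert)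
  moreover have "?g ` insert w U \<subseteq> V" using f z add_leaf.hyps by auto
  moreover have "adj (?g x) (?g y)" if xy: "{x, y} \<in> insert {u, w} F" for x y
  proof (cases "{x, y} = {u, w}")
    case True
    have "adj (f u) z" "adj z (f u)" "u \<noteq> w" using z sym[of "f u" z] add_leaf.hyps by auto
    moreover have "x = u \<and> y = w \<or> x = w \<and> y = u" using True by (simp add: doubleton_eq_iff)
    ultimately show ?thesis by auto
  next
    case False
    then have e: "{x, y} \<in> F" using xy by blast
    then have "x \<noteq> w" "y \<noteq> w" using built_edge_mem[OF add_leaf.hyps(1) e] add_leaf.hyps by auto
    then show ?thesis using f(3)[OF e] by simp
  qed
  ultimately show ?case by blast
qed

section \<open>Matchings and greedy choices\<close>

lemma not_in_Union_remove:
  assumes "pairwise disjnt M" "e \<in> M" "x \<in> e"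
  shows "x \<notin> \<Union>(M - {e})"
proof
  assume "x \<in> \<Union>(M - {e})"
  then obtain e' where "e' \<in> M" "e' \<noteq> e" "x \<in> e'" by blast
  then show False using pairwiseD[OF assms(1), of e' e] assms(2,3) by (auto simp: disjnt_def)
qed

text \<open>The alternating path through \<open>v\<close> cannot end in both \<open>u\<close> and \<open>w\<close>; the induction removes
  its first two edges.\<close>
lemma alternating_swap:
  assumes "finite M" "finite N" "pairwise disjnt M" "pairwise disjnt N"
    "\<And>e. e \<in> M \<union> N \<Longrightarrow> card e = 2"
    "v \<notin> \<Union>N" "u \<notin> \<Union>M" "w \<notin> \<Union>M" "u \<noteq> w"
  shows "(\<exists>M'\<subseteq>M \<union> N. pairwise disjnt M' \<and> card M' = card M \<and> v \<notin> \<Union>M' \<and> (u \<notin> \<Union>M' \<or> w \<notin> \<Union>M')) \<or>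
    (\<exists>N'\<subseteq>M \<union> N. pairwise disjnt N' \<and> card N' = Suc (card N))"
  using assms
proof (induction "card M" arbitrary: M N v)
  case 0
  then show ?case by (intro disjI1 exI[of _ M]) auto
next
  case (Suc c)
  show ?case
  proof (cases "v \<in> \<Union>M")
    case False
    then show ?thesis using Suc.prems by (intro disjI1 exI[of _ M]) auto
  next
    case True
    then obtain e1 where e1: "e1 \<in> M" "v \<in> e1" by blast
    then obtain v1 where v1: "e1 = {v, v1}" "v1 \<noteq> v"
      using Suc.prems(5)[of e1] by (auto simp: card_2_iff)
    have M1: "v \<notin> \<Union>(M - {e1})" "v1 \<notin> \<Union>(M - {e1})"
      using not_in_Union_remove[OF Suc.prems(3) e1(1)] v1(1) by auto
    show ?thesis
    proof (cases "v1 \<in> \<Union>N")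
      case False
      \<comment> \<open>The alternating path ends at \<open>v1\<close>: both ends of
        \<open>e1\<close> are missed by \<open>N\<close>, so \<open>N\<close> can be
        enlarged.\<close>
      have "pairwise disjnt (insert e1 N)"
        using Suc.prems(4,6) False v1 by (auto simp: pairwise_insert disjnt_def)
      moreover have "card (insert e1 N) = Suc (card N)"
        using Suc.prems(2,6) e1 by (auto simp: card_insert_if)
      ultimately show ?thesis using e1 by (intro disjI2 exI[of _ "insert e1 N"]) auto
    next
      case True
      then obtain e2 where e2: "e2 \<in> N" "v1 \<in> e2" by blast
      then obtain v2 where v2: "e2 = {v1, v2}" "v1 \<noteq> v2"
        using Suc.prems(5)[of e2] by (auto simp: card_2_iff)
      have vv2: "v2 \<noteq> v" using e2 v2 Suc.prems(6) by auto
      have N1: "v1 \<notin> \<Union>(N - {e2})" "v2 \<notin> \<Union>(N - {e2})"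
        using not_in_Union_remove[OF Suc.prems(4) e2(1)] v2(1) by auto
      have v1M: "v1 \<in> \<Union>M" using e1 v1 by auto
      have u1: "u \<noteq> v1" "w \<noteq> v1" using v1M Suc.prems(7,8) by auto
      have e2M: "e2 \<notin> M - {e1}" using M1 e2 by auto
      have cM: "card (M - {e1}) = c" using Suc.hyps(2) Suc.prems(1) e1 by simp
      have pM: "pairwise disjnt (M - {e1})" "pairwise disjnt (N - {e2})"
        using Suc.prems(3,4) by (auto elim: pairwise_subset)
      show ?thesis
      proof (cases "v2 \<in> \<Union>M")
        case False
        \<comment> \<open>The path ends at \<open>v2\<close>. Exchanging \<open>e1\<close> for
          \<open>e2\<close> frees \<open>v\<close> and newly covers only \<open>v2\<close>, which
          cannot be both \<open>u\<close> and \<open>w\<close>.\<close>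
        let ?M = "insert e2 (M - {e1})"
        have "pairwise disjnt ?M"
          using pM(1) M1 False v2 by (auto simp: pairwise_insert disjnt_def)
        moreover have "card ?M = card M"
          using e2M cM Suc.prems(1) Suc.hyps(2) by simp
        moreover have "v \<notin> \<Union>?M" using M1 v1 v2 vv2 by auto
        moreover have "u \<notin> \<Union>?M \<or> w \<notin> \<Union>?M" using Suc.prems(7,8,9) u1 v2 by auto
        ultimately show ?thesis using e2 by (intro disjI1 exI[of _ ?M]) auto
      next
        case True
        have u2: "u \<noteq> v2" "w \<noteq> v2" using True Suc.prems(7,8) by auto
        \<comment> \<open>The path goes on: with \<open>e1\<close> and \<open>e2\<close> removed,
          the same situation recurs at \<open>v2\<close>.\<close>
        have "(\<exists>M'\<subseteq>(M - {e1}) \<union> (N - {e2}). pairwise disjnt M' \<and> card M' = card (M - {e1}) \<and>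
             v2 \<notin> \<Union>M' \<and> (u \<notin> \<Union>M' \<or> w \<notin> \<Union>M')) \<or>
          (\<exists>N'\<subseteq>(M - {e1}) \<union> (N - {e2}). pairwise disjnt N' \<and> card N' = Suc (card (N - {e2})))"
          using Suc.hyps(1)[of "M - {e1}" "N - {e2}" v2] Suc.prems N1 pM cM by auto
        then consider (same) M' where "M' \<subseteq> (M - {e1}) \<union> (N - {e2})" "pairwise disjnt M'"
            "card M' = card (M - {e1})" "v2 \<notin> \<Union>M'" "u \<notin> \<Union>M' \<or> w \<notin> \<Union>M'"
          | (larger) N' where "N' \<subseteq> (M - {e1}) \<union> (N - {e2})" "pairwise disjnt N'"
            "card N' = Suc (card (N - {e2}))"
          by blast
        then show ?thesis
        proof cases
          case M': same
          have fin: "finite M'" using M'(1) Suc.prems(1,2) by (meson finite_Diff finite_UnI finite_subset)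
          have nv: "v1 \<notin> \<Union>M'" "v \<notin> \<Union>M'" using M'(1) M1 N1 Suc.prems(6) by blast+
          let ?M = "insert e2 M'"
          have "pairwise disjnt ?M"
            using M'(2,4) nv v2 by (auto simp: pairwise_insert disjnt_def)
          moreover have "card ?M = card M"
            using nv e2 fin M'(3) cM Suc.hyps(2) by (auto simp: card_insert_if)
          moreover have "v \<notin> \<Union>?M" using nv v1 v2 vv2 by auto
          moreover have "u \<notin> \<Union>?M \<or> w \<notin> \<Union>?M" using M'(5) u1 u2 v2 by auto
          ultimately show ?thesis using e2 M'(1) by (intro disjI1 exI[of _ ?M]) auto
        next
          case N': larger
          have fin: "finite N'" using N'(1) Suc.prems(1,2) by (meson finite_Diff finite_UnI finite_subset)
          have nv: "v1 \<notin> \<Union>N'" "v \<notin> \<Union>N'" using N'(1) M1 N1 Suc.prems(6) by blast+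
          let ?N = "insert e1 N'"
          have "pairwise disjnt ?N"
            using N'(2) nv v1 by (auto simp: pairwise_insert disjnt_def)
          moreover have "card ?N = Suc (card N)"
          proof -
            have "card N' = card N" using N'(3) card_Suc_Diff1[OF Suc.prems(2) e2(1)] by simp
            moreover have "e1 \<notin> N'" using nv(2) e1(2) by auto
            ultimately show ?thesis using fin by simp
          qed
          ultimately show ?thesis using e1 N'(1) by (intro disjI2 exI[of _ ?N]) auto
        qed
      qed
    qed
  qed
qed

definition matching :: "'a set set \<Rightarrow> 'a set set \<Rightarrow> bool" where
  "matching E M \<longleftrightarrow> M \<subseteq> E \<and> pairwise disjnt M"

text \<open>A weak form of the Tutte--Berge formula. If every vertex is missed by some maximum matching,
  ``no maximum matching misses both'' is transitive (Gallai), so the two ends of a matching edge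
  together see at most one unmatched vertex.\<close>
lemma weak_tutte_berge:
  assumes "finite E" "\<And>e. e \<in> E \<Longrightarrow> card e = 2" "\<And>M. matching E M \<Longrightarrow> card M \<le> k"
  shows "\<exists>S Y. S \<subseteq> \<Union>E \<and> Y \<subseteq> \<Union>E \<and> S \<inter> Y = {} \<and> 3 * card S + card Y \<le> 3 * k \<and>
    (\<forall>e\<in>E. e \<inter> S \<noteq> {} \<or> e \<subseteq> Y)"
  using assms
proof (induction k arbitrary: E)
  case 0
  have "E = {}"
  proof (rule ccontr)
    assume "E \<noteq> {}"
    then obtain e where "e \<in> E" by blast
    then have "matching E {e}" by (simp add: matching_def)
    then show False using 0(3)[of "{e}"] by simp
  qed
  then show ?case by auto
next
  case (Suc k)
  have finU: "finite (\<Union>E)"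
    using Suc.prems(1,2) by (metis card.infinite finite_Union zero_neq_numeral)
  show ?case
  proof (cases "\<exists>x\<in>\<Union>E. \<forall>M. matching {e \<in> E. x \<notin> e} M \<longrightarrow> card M \<le> k")
    case True
    \<comment> \<open>Deleting \<open>x\<close> lowers the matching bound to \<open>k\<close>, and
      the gain of 3 in the budget pays for putting \<open>x\<close> into \<open>S\<close>.\<close>
    then obtain x where x: "x \<in> \<Union>E" "\<And>M. matching {e \<in> E. x \<notin> e} M \<Longrightarrow> card M \<le> k" by blast
    obtain S Y where SY: "S \<subseteq> \<Union>{e \<in> E. x \<notin> e}" "Y \<subseteq> \<Union>{e \<in> E. x \<notin> e}" "S \<inter> Y = {}"
      "3 * card S + card Y \<le> 3 * k" "\<forall>e\<in>{e \<in> E. x \<notin> e}. e \<inter> S \<noteq> {} \<or> e \<subseteq> Y"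
      using Suc.IH[of "{e \<in> E. x \<notin> e}"] Suc.prems(1,2) x(2) by auto
    have "card (insert x S) \<le> Suc (card S)"
      by (cases "finite S") (auto simp: card_insert_if)
    then show ?thesis
      using SY x by (intro exI[of _ "insert x S"] exI[of _ Y]) auto
  next
    case False
    have miss: "\<exists>M. matching E M \<and> card M = Suc k \<and> x \<notin> \<Union>M" if x: "x \<in> \<Union>E" for x
    proof -
      obtain M where M: "matching {e \<in> E. x \<notin> e} M" "\<not> card M \<le> k" using False x by blast
      then have "matching E M" "x \<notin> \<Union>M" by (auto simp: matching_def)
      then show ?thesis using Suc.prems(3)[of M] M(2) by (metis le_SucE)
    qed
    show ?thesis
    proof (cases "E = {}")
      case True
      then show ?thesis by auto
    next
      case False
      then obtain e0 where e0: "e0 \<in> E" by blast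
      then have "e0 \<noteq> {}" using Suc.prems(2)[of e0] by auto
      then obtain x0 where "x0 \<in> \<Union>E" using e0 by blast
      then obtain M where M: "matching E M" "card M = Suc k" using miss by blast
      have finM: "finite M" using M(2) by (metis card.infinite nat.distinct(1))
      define R where "R u v \<longleftrightarrow> (\<forall>N. matching E N \<and> card N = Suc k \<longrightarrow> u \<in> \<Union>N \<or> v \<in> \<Union>N)" for u v
      have Radj: "R u v" if e: "{u, v} \<in> E" for u v
        unfolding R_def
      proof (intro allI impI, rule ccontr)
        fix N assume N: "matching E N \<and> card N = Suc k" and no: "\<not> (u \<in> \<Union>N \<or> v \<in> \<Union>N)"
        have "matching E (insert {u, v} N)"
          using N no e by (auto simp: matching_def pairwise_insert disjnt_def)
        moreover have "card (insert {u, v} N) = Suc (Suc k)"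
        proof -
          have "finite N" using N by (metis card.infinite nat.distinct(1))
          moreover have "{u, v} \<notin> N" using no by auto
          ultimately show ?thesis using N by simp
        qed
        ultimately show False using Suc.prems(3) by fastforce
      qed
      have Rtrans: "R u w" if Ruv: "R u v" and Rvw: "R v w" and uw: "u \<noteq> w" and vE: "v \<in> \<Union>E" for u v w
        unfolding R_def
      proof (intro allI impI, rule ccontr)
        fix L assume L: "matching E L \<and> card L = Suc k" and no: "\<not> (u \<in> \<Union>L \<or> w \<in> \<Union>L)"
        obtain N where N: "matching E N" "card N = Suc k" "v \<notin> \<Union>N" using miss vE by blast
        have fin: "finite L" "finite N" using L N by (metis card.infinite nat.distinct(1))+
        have LN: "L \<union> N \<subseteq> E" using L N by (auto simp: matching_def)
        have "(\<exists>M'\<subseteq>L \<union> N. pairwise disjnt M' \<and> card M' = card L \<and> v \<notin> \<Union>M' \<and> (u \<notin> \<Union>M' \<or> w \<notin> \<Union>M')) \<or>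
          (\<exists>N'\<subseteq>L \<union> N. pairwise disjnt N' \<and> card N' = Suc (card N))"
          using L N fin no uw LN Suc.prems(2)
          by (intro alternating_swap) (auto simp: matching_def)
        then consider (same) M' where "M' \<subseteq> L \<union> N" "pairwise disjnt M'" "card M' = card L" "v \<notin> \<Union>M'"
            "u \<notin> \<Union>M' \<or> w \<notin> \<Union>M'"
          | (larger) N' where "N' \<subseteq> L \<union> N" "pairwise disjnt N'" "card N' = Suc (card N)"
          by blast
        then show False
        proof cases
          case same
          then have "matching E M'" using LN unfolding matching_def by blast
          moreover have "card M' = Suc k" using same(3) L by simp
          ultimately have "u \<in> \<Union>M'" "w \<in> \<Union>M'" using Ruv Rvw same(4) unfolding R_def by blast+
          then show False using same(5) by blast
        next
          case larger
          then have "matching E N'" using LN unfolding matching_def by blast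
          then show False using Suc.prems(3)[of N'] N(2) larger(3) by simp
        qed
      qed
      have ME: "M \<subseteq> E" using M by (simp add: matching_def)
      have "\<exists>e z. e \<in> M \<and> z \<in> e \<and> {u, z} \<in> E" if u: "u \<in> \<Union>E - \<Union>M" for u
      proof -
        obtain e where e: "e \<in> E" "u \<in> e" using u by blast
        then obtain z where z: "e = {u, z}" using Suc.prems(2)[OF e(1)] by (auto simp: card_2_iff)
        then have "z \<in> \<Union>M" using Radj[of u z] e u M unfolding R_def by blast
        then show ?thesis using e z by blast
      qed
      \<comment> \<open>Every vertex \<open>u\<close> missed by \<open>M\<close> is sent to a
        matching edge \<open>p u\<close> that contains a neighbour \<open>q u\<close> of it.\<close>
      then obtain p q where pq: "\<And>u. u \<in> \<Union>E - \<Union>M \<Longrightarrow> p u \<in> M \<and> q u \<in> p u \<and> {u, q u} \<in> E"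
        by metis
      \<comment> \<open>If \<open>u\<close> and \<open>w\<close> went to the same edge, the chain
        \<open>u\<close>, \<open>q u\<close>, \<open>q w\<close>, \<open>w\<close> of adjacent or
        equal vertices would give \<open>R u w\<close> by transitivity, but \<open>M\<close> misses
        both.\<close>
      have "inj_on p (\<Union>E - \<Union>M)"
      proof (rule inj_onI, rule ccontr)
        fix u w assume u: "u \<in> \<Union>E - \<Union>M" and w: "w \<in> \<Union>E - \<Union>M" and eq: "p u = p w" and ne: "u \<noteq> w"
        have pu: "p u \<in> E" using pq[OF u] ME by blast
        have qU: "q u \<in> \<Union>E" "q w \<in> \<Union>E" using pq[OF u] pq[OF w] ME by blast+
        have "q w \<in> \<Union>M" using pq[OF w] by (meson UnionI)
        then have uq: "u \<noteq> q w" using u by auto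
        have Ru: "R u (q u)" and Rw: "R (q w) w"
          using Radj pq[OF u] pq[OF w] by (auto simp: insert_commute)
        have "R u (q w)"
        proof (cases "q u = q w")
          case False
          then have "p u = {q u, q w}"
            using pq[OF u] pq[OF w] eq Suc.prems(2)[OF pu] by (auto simp: card_2_iff)
          then have "R (q u) (q w)" using Radj pu by simp
          then show ?thesis using Rtrans[OF Ru _ uq qU(1)] by blast
        qed (use Ru in simp)
        then have "R u w" using Rtrans[OF _ Rw ne qU(2)] by blast
        then show False using u w M unfolding R_def by blast
      qed
      then have "card (\<Union>E - \<Union>M) \<le> Suc k"
        using pq finM M(2) card_inj_on_le[of p "\<Union>E - \<Union>M" M] by auto
      moreover have "card (\<Union>M) \<le> 2 * Suc k"
      proof -
        have "card (\<Union>M) \<le> sum card M"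
          using card_Union_le_sum_card by blast
        also have "\<dots> \<le> (\<Sum>e\<in>M. 2)" using ME Suc.prems(2) by (intro sum_mono) auto
        finally show ?thesis using M(2) by simp
      qed
      moreover have "card (\<Union>E) = card (\<Union>E - \<Union>M) + card (\<Union>M)"
        using finU ME by (metis Union_mono card_Diff_subset card_mono diff_add finite_subset)
      \<comment> \<open>Each matching edge accounts for its two ends and at most one missed vertex,
        so \<open>Y\<close> can take everything and \<open>S\<close> is empty.\<close>
      ultimately have "card (\<Union>E) \<le> 3 * Suc k" by simp
      then show ?thesis by (intro exI[of _ "{}"] exI[of _ "\<Union>E"]) auto
    qed
  qed
qed

section \<open>Greedy systems of representatives, stars and cherries\<close>

lemma greedy_choice:
  assumes "finite A" "\<And>a. a \<in> A \<Longrightarrow> card A \<le> card (F a)"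
  shows "\<exists>g. inj_on g A \<and> (\<forall>a\<in>A. g a \<in> F a)"
  using assms
proof (induction A rule: finite_induct)
  case (insert a A)
  then obtain g where g: "inj_on g A" "\<forall>a\<in>A. g a \<in> F a"
    by (metis card_insert_disjoint insertI2 Suc_leD)
  have "card (g ` A) \<le> card A" using insert.hyps(1) by (simp add: card_image_le)
  also have "\<dots> < card (F a)" using insert.prems[of a] insert.hyps by simp
  finally have "\<not> F a \<subseteq> g ` A"
    using insert.hyps(1) by (meson card_mono finite_imageI not_less)
  then obtain y where y: "y \<in> F a" "y \<notin> g ` A" by blast
  have "inj_on (g(a := y)) (insert a A)"
    using inj_on_fun_updI[OF g(1) y(2), of a] y(2) insert.hyps(2) by (auto simp: inj_on_insert)
  moreover have "\<forall>b\<in>insert a A. (g(a := y)) b \<in> F b" using g y insert.hyps(2) by auto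
  ultimately show ?case by blast
qed simp

text \<open>Attach the stars one by one, the leaf \<open>x\<close> belonging to the star of \<open>par x\<close>. If this gets stuck at
  a star with \<open>c\<close> leaves, then no unused centre has \<open>c\<close> unused neighbours.\<close>
lemma star_system:
  fixes R :: "'v \<Rightarrow> 'w \<Rightarrow> bool" and par :: "'x \<Rightarrow> 'p"
  assumes "finite X" "finite W"
  shows "(\<exists>f g. inj_on f (par ` X) \<and> f ` par ` X \<subseteq> A \<and> inj_on g X \<and> g ` X \<subseteq> W \<and>
        (\<forall>x\<in>X. R (f (par x)) (g x))) \<or>
    (\<exists>A1 W1 p. A1 \<subseteq> A \<and> finite A1 \<and> W1 \<subseteq> W \<and> p \<in> par ` X \<and>
        card A1 + card {x \<in> X. par x = p} \<le> card X \<and>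
        card W1 + card {x \<in> X. par x = p} \<le> card X \<and>
        (\<forall>a\<in>A - A1. card {y \<in> W - W1. R a y} < card {x \<in> X. par x = p}))"
    (is "?full \<or> ?fail")
proof (rule disjCI)
  assume nf: "\<not> ?fail"
  have "\<exists>f g. inj_on f P \<and> f ` P \<subseteq> A \<and> inj_on g {x \<in> X. par x \<in> P} \<and> g ` {x \<in> X. par x \<in> P} \<subseteq> W \<and>
    (\<forall>x\<in>{x \<in> X. par x \<in> P}. R (f (par x)) (g x))" if "finite P" "P \<subseteq> par ` X" for P
    using that
  proof (induction P rule: finite_induct)
    case (insert p P)
    let ?XP = "{x \<in> X. par x \<in> P}" and ?Xp = "{x \<in> X. par x = p}"
    obtain f g where fg: "inj_on f P" "f ` P \<subseteq> A" "inj_on g ?XP" "g ` ?XP \<subseteq> W"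
      "\<And>x. x \<in> ?XP \<Longrightarrow> R (f (par x)) (g x)"
      using insert.IH insert.prems by auto
    have "card ?XP + card ?Xp = card (?XP \<union> ?Xp)"
      using assms(1) insert.hyps(2) by (intro card_Un_disjoint[symmetric]) auto
    also have "\<dots> \<le> card X" using assms(1) by (intro card_mono) auto
    finally have cX: "card ?XP + card ?Xp \<le> card X" .
    \<comment> \<open>Each star has at least one leaf, so there are at most as many used centres as
      used leaves.\<close>
    have "P \<subseteq> par ` ?XP" using insert.prems by auto
    then have "card P \<le> card ?XP" using assms(1) by (intro surj_card_le) auto
    then have cardP: "card (f ` P) + card ?Xp \<le> card X" "card (g ` ?XP) + card ?Xp \<le> card X"
      using cX card_image[OF fg(1)] card_image[OF fg(3)] by auto
    \<comment> \<open>Otherwise the centres and leaves placed so far would witness the stuck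
      alternative.\<close>
    have "\<not> (\<forall>a\<in>A - f ` P. card {y \<in> W - g ` ?XP. R a y} < card ?Xp)"
    proof (rule contrapos_nn[OF nf])
      assume "\<forall>a\<in>A - f ` P. card {y \<in> W - g ` ?XP. R a y} < card ?Xp"
      then show ?fail
        using fg(2,4) insert.prems insert.hyps(1) cardP
        by (intro exI[of _ "f ` P"] exI[of _ "g ` ?XP"] exI[of _ p]) simp
    qed
    then obtain a where a: "a \<in> A" "a \<notin> f ` P" "card ?Xp \<le> card {y \<in> W - g ` ?XP. R a y}"
      by (auto simp: not_less)
    obtain h where h: "inj_on h ?Xp" "\<forall>x\<in>?Xp. h x \<in> {y \<in> W - g ` ?XP. R a y}"
      using greedy_choice[of ?Xp "\<lambda>_. {y \<in> W - g ` ?XP. R a y}"] a(3) assms(1) by auto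
    let ?f = "f(p := a)" and ?g = "\<lambda>x. if par x = p then h x else g x"
    have "inj_on ?f (insert p P)"
      using inj_on_fun_updI[OF fg(1) a(2), of p] a(2) insert.hyps(2) by (auto simp: inj_on_insert)
    moreover have "?f ` insert p P \<subseteq> A" using fg(2) a(1) insert.hyps(2) by auto
    moreover have "inj_on ?g {x \<in> X. par x \<in> insert p P}"
    proof (rule inj_onI)
      fix x y assume xy: "x \<in> {x \<in> X. par x \<in> insert p P}" "y \<in> {x \<in> X. par x \<in> insert p P}" "?g x = ?g y"
      consider "par x = p" "par y = p" | "par x = p" "par y \<noteq> p" | "par x \<noteq> p" "par y = p"
        | "par x \<noteq> p" "par y \<noteq> p" by blast
      then show "x = y"
      proof cases
        case 1 then show ?thesis using xy inj_onD[OF h(1), of x y] by auto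
      next
        case 2 then show ?thesis using xy h(2) by auto
      next
        case 3
        then have "h y \<notin> g ` ?XP" using xy h(2) by blast
        then show ?thesis using 3 xy imageI[of x ?XP g] by auto
      next
        case 4 then show ?thesis using xy inj_onD[OF fg(3), of x y] by auto
      qed
    qed
    moreover have "?g ` {x \<in> X. par x \<in> insert p P} \<subseteq> W" using fg(4) h(2) by auto
    moreover have "\<forall>x\<in>{x \<in> X. par x \<in> insert p P}. R (?f (par x)) (?g x)" using fg(5) h(2) by auto
    ultimately show ?case by (intro exI[of _ ?f] exI[of _ ?g] conjI)
  qed simp
  note full = this
  have "{x \<in> X. par x \<in> par ` X} = X" by blast
  then show ?full using full[of "par ` X"] assms(1) by auto
qed

lemma star_system_cases:
  fixes R :: "'v \<Rightarrow> 'w \<Rightarrow> bool" and par :: "'x \<Rightarrow> 'p"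
  assumes "finite X" "finite W"
  obtains (full) f g where "inj_on f (par ` X)" "f ` par ` X \<subseteq> A" "inj_on g X" "g ` X \<subseteq> W"
      "\<forall>x\<in>X. R (f (par x)) (g x)"
    | (stuck) A1 W1 p where "A1 \<subseteq> A" "finite A1" "W1 \<subseteq> W" "p \<in> par ` X"
        "card A1 + card {x \<in> X. par x = p} \<le> card X"
        "card W1 + card {x \<in> X. par x = p} \<le> card X"
        "\<forall>a\<in>A - A1. card {y \<in> W - W1. R a y} < card {x \<in> X. par x = p}"
  using star_system[OF assms, of par A R]
  by (elim disjE exE conjE) (rule full stuck; assumption)+

text \<open>In the second case \<open>A1\<close> and \<open>W1\<close> are the vertices used by a maximal family of disjoint cherries.\<close>
lemma cherry_system:
  fixes R :: "'w \<Rightarrow> 'v \<Rightarrow> bool"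
  assumes "finite X" "finite A"
  shows "(\<exists>g p q. inj_on g X \<and> g ` X \<subseteq> W \<and> inj_on p X \<and> inj_on q X \<and> p ` X \<inter> q ` X = {} \<and>
        p ` X \<subseteq> A \<and> q ` X \<subseteq> A \<and> (\<forall>x\<in>X. R (g x) (p x) \<and> R (g x) (q x))) \<or>
    (\<exists>A1 W1. A1 \<subseteq> A \<and> W1 \<subseteq> W \<and> finite W1 \<and> card W1 < card X \<and> card A1 + 2 \<le> 2 * card X \<and>
        (\<forall>y\<in>W - W1. card {a \<in> A - A1. R y a} \<le> 1))"
  using assms(1)
proof (induction X rule: finite_induct)
  case (insert x X)
  have mono: ?case if "\<exists>A1 W1. A1 \<subseteq> A \<and> W1 \<subseteq> W \<and> finite W1 \<and> card W1 < card X \<and> card A1 + 2 \<le> 2 * card X \<and>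
        (\<forall>y\<in>W - W1. card {a \<in> A - A1. R y a} \<le> 1)"
  proof -
    have c: "card (insert x X) = Suc (card X)" using insert.hyps by simp
    from that obtain A1 W1 where *: "A1 \<subseteq> A" "W1 \<subseteq> W" "finite W1" "card W1 < card X"
      "card A1 + 2 \<le> 2 * card X" "\<forall>y\<in>W - W1. card {a \<in> A - A1. R y a} \<le> 1" by blast
    show ?thesis
      unfolding c using * by (intro disjI2 exI[of _ A1] exI[of _ W1]) simp
  qed
  from insert.IH show ?case
  proof (rule disjE)
    assume "\<exists>g p q. inj_on g X \<and> g ` X \<subseteq> W \<and> inj_on p X \<and> inj_on q X \<and> p ` X \<inter> q ` X = {} \<and>
        p ` X \<subseteq> A \<and> q ` X \<subseteq> A \<and> (\<forall>x\<in>X. R (g x) (p x) \<and> R (g x) (q x))"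
    then obtain g p q where fg: "inj_on g X" "g ` X \<subseteq> W" "inj_on p X" "inj_on q X" "p ` X \<inter> q ` X = {}"
        "p ` X \<subseteq> A" "q ` X \<subseteq> A" "\<And>x. x \<in> X \<Longrightarrow> R (g x) (p x) \<and> R (g x) (q x)"
      by auto
    let ?A1 = "p ` X \<union> q ` X"
    show ?thesis
    proof (cases "\<forall>y\<in>W - g ` X. card {a \<in> A - ?A1. R y a} \<le> 1")
      case True
      have "card ?A1 \<le> 2 * card X"
        using card_Un_le[of "p ` X" "q ` X"] card_image_le[OF insert.hyps(1), of p]
          card_image_le[OF insert.hyps(1), of q] by linarith
      moreover have "card (g ` X) \<le> card X" using insert.hyps(1) by (simp add: card_image_le)
      ultimately show ?thesis
        using True fg insert.hyps by (intro disjI2 exI[of _ ?A1] exI[of _ "g ` X"]) auto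
    next
      case False
      then obtain y where y: "y \<in> W" "y \<notin> g ` X" "2 \<le> card {a \<in> A - ?A1. R y a}"
        by (auto simp: not_le)
      obtain D where D: "D \<subseteq> {a \<in> A - ?A1. R y a}" "card D = 2"
        by (rule obtain_subset_with_card_n[OF y(3)])
      obtain a b where "D = {a, b}" "a \<noteq> b" using D(2) by (auto simp: card_2_iff)
      then have ab: "a \<noteq> b" "a \<in> A" "b \<in> A" "a \<notin> ?A1" "b \<notin> ?A1" "R y a" "R y b"
        using D(1) by auto
      let ?g = "g(x := y)" and ?p = "p(x := a)" and ?q = "q(x := b)"
      have im: "?g ` insert x X = insert y (g ` X)" "?p ` insert x X = insert a (p ` X)"
        "?q ` insert x X = insert b (q ` X)" using insert.hyps(2) by auto
      have "inj_on ?g (insert x X)" "inj_on ?p (insert x X)" "inj_on ?q (insert x X)"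
        using inj_on_fun_updI[OF fg(1) y(2), of x] inj_on_fun_updI[OF fg(3), of a x]
          inj_on_fun_updI[OF fg(4), of b x] ab(4,5) y(2) insert.hyps(2)
        by (auto simp: inj_on_insert)
      moreover have "?p ` insert x X \<inter> ?q ` insert x X = {}" unfolding im using ab(1,4,5) fg(5) by auto
      moreover have "?g ` insert x X \<subseteq> W" "?p ` insert x X \<subseteq> A" "?q ` insert x X \<subseteq> A"
        unfolding im using fg(2,6,7) ab(2,3) y(1) by auto
      moreover have "\<forall>z\<in>insert x X. R (?g z) (?p z) \<and> R (?g z) (?q z)"
        using fg(8) ab insert.hyps(2) by auto
      ultimately show ?thesis
        by (intro disjI1 exI[of _ ?g] exI[of _ ?p] exI[of _ ?q] conjI)
    qed
  qed (rule mono)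
qed simp

section \<open>Cores in graphs without fans in the complement\<close>

definition embeds :: "'a set \<Rightarrow> ('a \<Rightarrow> 'a \<Rightarrow> bool) \<Rightarrow> 'v set \<Rightarrow> ('v \<Rightarrow> 'v \<Rightarrow> bool) \<Rightarrow> bool" where
  "embeds U t V adj \<longleftrightarrow> (\<exists>f. inj_on f U \<and> f ` U \<subseteq> V \<and> (\<forall>x\<in>U. \<forall>y\<in>U. t x y \<longrightarrow> adj (f x) (f y)))"

definition nonedges :: "('v \<Rightarrow> 'v \<Rightarrow> bool) \<Rightarrow> 'v set \<Rightarrow> 'v set set" where
  "nonedges adj B = {{x, y} | x y. x \<in> B \<and> y \<in> B \<and> x \<noteq> y \<and> \<not> adj x y}"

lemma inj_on_UnI: "inj_on f A \<Longrightarrow> inj_on f B \<Longrightarrow> f ` A \<inter> f ` B = {} \<Longrightarrow> inj_on f (A \<union> B)"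
  by (auto simp: inj_on_Un)

lemma nonedgesI: "x \<in> B \<Longrightarrow> y \<in> B \<Longrightarrow> x \<noteq> y \<Longrightarrow> \<not> adj x y \<Longrightarrow> {x, y} \<in> nonedges adj B"
  by (auto simp: nonedges_def)

lemma nonedges_mono: "B \<subseteq> C \<Longrightarrow> nonedges adj B \<subseteq> nonedges adj C"
  unfolding nonedges_def by blast

definition nbrs :: "('v \<Rightarrow> 'v \<Rightarrow> bool) \<Rightarrow> 'v \<Rightarrow> 'v set \<Rightarrow> 'v set" where
  "nbrs adj x B = {y \<in> B. y \<noteq> x \<and> adj x y}"

definition nonnbrs :: "('v \<Rightarrow> 'v \<Rightarrow> bool) \<Rightarrow> 'v \<Rightarrow> 'v set \<Rightarrow> 'v set" where
  "nonnbrs adj x B = {y \<in> B. y \<noteq> x \<and> \<not> adj x y}"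

lemma card_nbrs_nonnbrs:
  assumes "finite B" "x \<notin> B"
  shows "card (nbrs adj x B) + card (nonnbrs adj x B) = card B"
proof -
  have "B = nbrs adj x B \<union> nonnbrs adj x B" using assms(2) by (auto simp: nbrs_def nonnbrs_def)
  moreover have "card (nbrs adj x B \<union> nonnbrs adj x B) = card (nbrs adj x B) + card (nonnbrs adj x B)"
    using assms(1) by (intro card_Un_disjoint) (auto simp: nbrs_def nonnbrs_def)
  ultimately show ?thesis by simp
qed

text \<open>\<open>adj\<close> is the graph on \<open>2 * n - 1\<close> vertices and
  \<open>k\<close> is \<open>m - 1\<close>, so that \<open>n_ge\<close> reads
  \<open>m^2 - m + 1 \<le> n\<close>. A matching among the nonedges inside the non-neighbourhood of
  \<open>y\<close> is a fan with centre \<open>y\<close> in the complement.\<close>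

locale fan_free =
  fixes V :: "'v set" and adj :: "'v \<Rightarrow> 'v \<Rightarrow> bool" and n k :: nat
  assumes finite_V: "finite V"
    and adj_sym: "adj x y \<Longrightarrow> adj y x"
    and card_V: "card V + 1 = 2 * n"
    and n_ge: "k * k + k + 1 \<le> n"
    and k_ge: "8 \<le> k"
    and no_fan: "y \<in> V \<Longrightarrow> matching (nonedges adj (nonnbrs adj y V)) M \<Longrightarrow> card M \<le> k"
begin

text \<open>Lets linear arithmetic compare \<open>n_ge\<close> with multiples of \<open>k\<close>,
  treating \<open>k * k\<close> as an atom.\<close>

lemma k_sq: "8 * k \<le> k * k"
  using k_ge by simp

text \<open>A core can take all but \<open>b\<close> vertices of the tree; these must be attached to it from outside.\<close>
definition core :: "'v set \<Rightarrow> 'v set \<Rightarrow> nat \<Rightarrow> bool" where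
  "core A Y b \<longleftrightarrow> A \<union> Y \<subseteq> V \<and> A \<inter> Y = {} \<and> (\<forall>a\<in>A. \<forall>c\<in>A \<union> Y. a \<noteq> c \<longrightarrow> adj a c) \<and>
    card A + card Y + b = n \<and> card Y + 3 * b \<le> 3 * k"

lemma coreD:
  assumes "core A Y b"
  shows "A \<subseteq> V" "Y \<subseteq> V" "finite A" "finite Y" "A \<inter> Y = {}"
    "\<And>a c. a \<in> A \<Longrightarrow> c \<in> A \<Longrightarrow> a \<noteq> c \<Longrightarrow> adj a c"
    "\<And>a c. a \<in> A \<Longrightarrow> c \<in> Y \<Longrightarrow> adj a c" "\<And>a c. a \<in> A \<Longrightarrow> c \<in> Y \<Longrightarrow> adj c a"
    "card A + card Y + b = n" "card Y + 3 * b \<le> 3 * k" "n + 2 * b \<le> card A + 3 * k" "b \<le> k"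
proof -
  have *: "A \<union> Y \<subseteq> V" "A \<inter> Y = {}" "\<forall>a\<in>A. \<forall>c\<in>A \<union> Y. a \<noteq> c \<longrightarrow> adj a c"
    "card A + card Y + b = n" "card Y + 3 * b \<le> 3 * k"
    using assms by (simp_all add: core_def)
  show "A \<subseteq> V" "Y \<subseteq> V" "finite A" "finite Y" "A \<inter> Y = {}"
    using * finite_V finite_subset by auto
  show "adj a c" if "a \<in> A" "c \<in> A" "a \<noteq> c" for a c using * that by blast
  show ac: "adj a c" if "a \<in> A" "c \<in> Y" for a c
  proof -
    have "a \<noteq> c" using *(2) that by blast
    then show ?thesis using *(3) that by simp
  qed
  show "adj c a" if "a \<in> A" "c \<in> Y" for a c
    using adj_sym[OF ac[OF that]] .
  show "card A + card Y + b = n" "card Y + 3 * b \<le> 3 * k" "n + 2 * b \<le> card A + 3 * k" "b \<le> k"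
    using * by simp_all
qed

text \<open>Apply \<open>weak_tutte_berge\<close> to the nonedges inside \<open>W\<close> and drop
  \<open>S\<close>. The remaining nonedges lie inside \<open>Y\<close>, so the rest of
  \<open>W\<close> is a clique joined to \<open>Y\<close>; the defect is
  \<open>card S\<close>.\<close>

lemma core_exists:
  assumes W: "W \<subseteq> V" "card W = n" and mat: "\<And>M. matching (nonedges adj W) M \<Longrightarrow> card M \<le> k"
  shows "\<exists>A Y b. core A Y b \<and> A \<union> Y \<subseteq> W"
proof -
  have finW: "finite W" using W(1) finite_V finite_subset by blast
  have sub: "nonedges adj W \<subseteq> Pow W" by (auto simp: nonedges_def)
  then have "finite (nonedges adj W)" using finW finite_subset by blast
  moreover have "card e = 2" if "e \<in> nonedges adj W" for e using that by (auto simp: nonedges_def)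
  ultimately obtain S Y where SY: "S \<subseteq> \<Union>(nonedges adj W)" "Y \<subseteq> \<Union>(nonedges adj W)" "S \<inter> Y = {}"
    "3 * card S + card Y \<le> 3 * k" "\<And>e. e \<in> nonedges adj W \<Longrightarrow> e \<inter> S \<noteq> {} \<or> e \<subseteq> Y"
    using weak_tutte_berge[of "nonedges adj W" k] mat by metis
  have S: "S \<subseteq> W" "Y \<subseteq> W" using SY(1,2) sub by auto
  then have fin: "finite S" "finite Y" using finW finite_subset by auto
  let ?A = "W - (S \<union> Y)"
  have "card (S \<union> Y) = card S + card Y" using SY(3) fin by (simp add: card_Un_disjoint)
  then have "card ?A + (card S + card Y) = n"
    using S W finW card_mono[of W "S \<union> Y"] by (simp add: card_Diff_subset fin)
  moreover have "adj a c" if ac: "a \<in> ?A" "c \<in> ?A \<union> Y" "a \<noteq> c" for a c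
  proof (rule ccontr)
    assume "\<not> adj a c"
    then have "{a, c} \<in> nonedges adj W" using ac S by (intro nonedgesI) auto
    then show False using SY(5)[of "{a, c}"] ac SY(3) by auto
  qed
  ultimately have "core ?A Y (card S)"
    using SY(4) S W(1) by (auto simp: core_def)
  then show ?thesis using S by blast
qed

text \<open>All vertices of \<open>Q\<close> miss \<open>y\<close>, so a large matching of nonedges
  among them would be a fan with centre \<open>y\<close>.\<close>

lemma core_exists_nonnbrs:
  assumes "y \<in> V" "Q \<subseteq> nonnbrs adj y V" "n \<le> card Q"
  shows "\<exists>A Y b. core A Y b \<and> A \<union> Y \<subseteq> Q"
proof -
  obtain W where W: "W \<subseteq> Q" "card W = n" by (rule obtain_subset_with_card_n[OF assms(3)])
  have "W \<subseteq> nonnbrs adj y V" using W assms by blast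
  then have "matching (nonedges adj W) M \<Longrightarrow> matching (nonedges adj (nonnbrs adj y V)) M" for M
    using nonedges_mono by (fastforce simp: matching_def)
  moreover have "W \<subseteq> V" using W assms by (auto simp: nonnbrs_def)
  ultimately obtain A Y b where "core A Y b" "A \<union> Y \<subseteq> W"
    using core_exists[of W] W(2) no_fan[OF assms(1)] by blast
  then show ?thesis using W by blast
qed

text \<open>Greedily match \<open>k + 1\<close> vertices of \<open>N\<close> to distinct
  non-neighbours in \<open>N'\<close>; with centre \<open>y\<close> this is a forbidden fan.\<close>

lemma bipartite_fan:
  assumes "y \<in> V" "N \<subseteq> nonnbrs adj y V" "N' \<subseteq> nonnbrs adj y V" "N \<inter> N' = {}"
    "k < card N" "\<And>a. a \<in> N \<Longrightarrow> k < card (nonnbrs adj a N')"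
  shows False
proof -
  obtain L where L: "L \<subseteq> N" "card L = Suc k" "finite L"
    using obtain_subset_with_card_n[of "Suc k" N] assms(5) by (metis Suc_leI)
  obtain g where g: "inj_on g L" "\<And>a. a \<in> L \<Longrightarrow> g a \<in> nonnbrs adj a N'"
    using greedy_choice[of L "\<lambda>a. nonnbrs adj a N'"] L assms(6) by (metis Suc_leI subsetD)
  have gN: "g a \<in> N'" "g a \<noteq> a" "\<not> adj a (g a)" "a \<in> N" if "a \<in> L" for a
    using g(2)[OF that] that L(1) by (auto simp: nonnbrs_def)
  have ne: "a \<noteq> g b" if "a \<in> L" "b \<in> L" for a b using gN[OF that(1)] gN[OF that(2)] assms(4) by blast
  let ?M = "(\<lambda>a. {a, g a}) ` L"
  have disj: "{a, g a} \<inter> {b, g b} = {}" if "a \<in> L" "b \<in> L" "a \<noteq> b" for a b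
    using ne[OF that(1,2)] ne[OF that(2,1)] that inj_onD[OF g(1), of a b] by auto
  have "{a, g a} \<in> nonedges adj (nonnbrs adj y V)" if "a \<in> L" for a
    using gN[OF that] assms(2,3) by (intro nonedgesI) auto
  moreover have "pairwise disjnt ?M"
  proof (rule pairwiseI)
    fix e e' assume "e \<in> ?M" "e' \<in> ?M" "e \<noteq> e'"
    then obtain a b where "a \<in> L" "b \<in> L" "e = {a, g a}" "e' = {b, g b}" by blast
    then show "disjnt e e'" using disj[of a b] \<open>e \<noteq> e'\<close> unfolding disjnt_def by metis
  qed
  ultimately have "matching (nonedges adj (nonnbrs adj y V)) ?M" unfolding matching_def by blast
  moreover have "inj_on (\<lambda>a. {a, g a}) L"
  proof (rule inj_onI, rule ccontr)
    fix a b assume "a \<in> L" "b \<in> L" "{a, g a} = {b, g b}" "a \<noteq> b"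
    then show False using disj[of a b] by auto
  qed
  ultimately show False using no_fan[OF assms(1), of ?M] L(2) by (simp add: card_image)
qed

end

text \<open>A hypothetical counterexample. The tree appears as a symmetric relation with a
  two-colouring, its degree sum and non-adjacent leaves; \<open>sparse_vertex\<close> is what a
  failed greedy embedding provides.\<close>

locale tree_free = fan_free V adj n k
  for V :: "'v set" and adj :: "'v \<Rightarrow> 'v \<Rightarrow> bool" and n k :: nat +
  fixes U :: "'a set" and t :: "'a \<Rightarrow> 'a \<Rightarrow> bool" and col :: "'a \<Rightarrow> bool"
  assumes finite_U: "finite U"
    and card_U: "card U = n"
    and t_sym: "t x y \<Longrightarrow> t y x"
    and t_col: "t x y \<Longrightarrow> col x \<noteq> col y"
    and degree_sum: "(\<Sum>x\<in>U. card {y \<in> U. t x y}) + 2 = 2 * card U"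
    and degree_pos: "x \<in> U \<Longrightarrow> 0 < card {y \<in> U. t x y}"
    and leaves_nonadjacent:
      "\<lbrakk>x \<in> U; y \<in> U; t x y; card {y \<in> U. t x y} = 1\<rbrakk> \<Longrightarrow> card {x \<in> U. t y x} \<noteq> 1"
    and no_embedding: "\<not> embeds U t V adj"
    and sparse_vertex: "\<exists>v\<in>V. n \<le> card (nonnbrs adj v V)"
begin

section \<open>Leaves of the tree, and embeddings through a core\<close>

definition deg :: "'a \<Rightarrow> nat" where "deg x = card {y \<in> U. t x y}"

definition leaves :: "'a set" where "leaves = {x \<in> U. deg x = 1}"

text \<open>Meaningful for leaves only, whose neighbourhood is a singleton.\<close>

definition parent :: "'a \<Rightarrow> 'a" where "parent x = the_elem {y \<in> U. t x y}"

lemma leafD: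
  assumes "x \<in> leaves"
  shows "x \<in> U" "parent x \<in> U" "t x (parent x)" "t (parent x) x" "\<And>y. y \<in> U \<Longrightarrow> t x y \<Longrightarrow> y = parent x"
    "parent x \<notin> leaves"
proof -
  have x: "x \<in> U" "card {y \<in> U. t x y} = 1" using assms by (auto simp: leaves_def deg_def)
  then obtain p where p: "{y \<in> U. t x y} = {p}" by (auto simp: card_1_singleton_iff)
  then have pp: "parent x = p" by (simp add: parent_def)
  show "x \<in> U" by (rule x)
  show p1: "parent x \<in> U" and p2: "t x (parent x)" using p pp by auto
  show "t (parent x) x" using p2 t_sym by blast
  show "y = parent x" if "y \<in> U" "t x y" for y using p pp that by blast
  show "parent x \<notin> leaves"
    using leaves_nonadjacent[OF x(1) p1 p2 x(2)] by (auto simp: leaves_def deg_def)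
qed

text \<open>The larger colour class of \<open>C\<close> serves as \<open>J\<close>.\<close>

lemma independent_half:
  assumes "finite C"
  shows "\<exists>J\<subseteq>C. card C \<le> 2 * card J \<and> (\<forall>x\<in>J. \<forall>y\<in>J. \<not> t x y)"
proof -
  let ?a = "{x \<in> C. col x}" and ?b = "{x \<in> C. \<not> col x}"
  have "card C = card (?a \<union> ?b)" by (rule arg_cong[of _ _ card]) blast
  also have "\<dots> = card ?a + card ?b" using assms by (intro card_Un_disjoint) auto
  finally have "card C \<le> 2 * card ?a \<or> card C \<le> 2 * card ?b" by linarith
  then show ?thesis
  proof
    assume "card C \<le> 2 * card ?a"
    then show ?thesis using t_col by (intro exI[of _ ?a]) auto
  next
    assume "card C \<le> 2 * card ?b"
    then show ?thesis using t_col by (intro exI[of _ ?b]) auto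
  qed
qed

text \<open>The unmapped part of the tree goes into the core; an independent set takes the vertices of \<open>Y\<close>.\<close>
lemma extend_embedding:
  assumes c: "core A Y b" and U': "U' \<subseteq> U" "D \<subseteq> U'"
    and f: "inj_on f D" "f ` D \<subseteq> V" "f ` D \<inter> Y = {}"
      "\<And>x y. x \<in> D \<Longrightarrow> y \<in> D \<Longrightarrow> t x y \<Longrightarrow> adj (f x) (f y)"
      "\<And>x y. x \<in> D \<Longrightarrow> y \<in> U' - D \<Longrightarrow> t x y \<Longrightarrow> f x \<in> A"
    and size: "card (U' - D) \<le> card (A - f ` D) + card Y" "card (U' - D) \<le> 2 * card (A - f ` D)"
  shows "\<exists>g. inj_on g U' \<and> g ` U' \<subseteq> V \<and> (\<forall>x\<in>D. g x = f x) \<and>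
    (\<forall>x\<in>U'. \<forall>y\<in>U'. t x y \<longrightarrow> adj (g x) (g y))"
proof -
  let ?C = "U' - D" and ?A = "A - f ` D"
  note core = coreD[OF c]
  have finC: "finite ?C" using finite_U U' finite_subset by blast
  obtain J where J: "J \<subseteq> ?C" "card ?C \<le> 2 * card J" "\<And>x y. x \<in> J \<Longrightarrow> y \<in> J \<Longrightarrow> \<not> t x y"
    using independent_half[OF finC] by blast
  \<comment> \<open>The overflow beyond \<open>?A\<close> is at most half of \<open>?C\<close>, so
    it fits into the independent set \<open>J\<close>. Independence matters because nothing is known
    about adjacency inside \<open>Y\<close>.\<close>
  have "card ?C - card ?A \<le> card J" using J(2) size(2) by linarith
  then obtain I where I: "I \<subseteq> J" "card I = card ?C - card ?A" "finite I"
    by (rule obtain_subset_with_card_n)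
  have IC: "I \<subseteq> ?C" using I J by blast
  have finA: "finite ?A" using core(3) by simp
  have "card I \<le> card Y" using I(2) size(1) by linarith
  then obtain h where h: "inj_on h I" "h ` I \<subseteq> Y"
    using card_le_inj[OF I(3) core(4)] by blast
  have "card (?C - I) \<le> card ?A"
    using card_Diff_subset[OF I(3) IC] I(2) by linarith
  then obtain a where a: "inj_on a (?C - I)" "a ` (?C - I) \<subseteq> ?A"
    using card_le_inj[of "?C - I" ?A] finC finA by blast
  define g where "g x = (if x \<in> D then f x else if x \<in> I then h x else a x)" for x
  have gD: "g x = f x" if "x \<in> D" for x using that by (simp add: g_def)
  have gI: "g x \<in> Y" "g x = h x" if "x \<in> I" for x using that h IC by (auto simp: g_def)
  have gC: "g x \<in> A" "g x \<notin> f ` D" "g x = a x" if "x \<in> ?C - I" for x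
    using that a by (auto simp: g_def)
  have gim: "g ` I \<subseteq> Y" "g ` (?C - I) \<subseteq> A" "g ` (?C - I) \<inter> f ` D = {}"
    using gI(1) gC(1,2) by auto
  have "inj_on g (D \<union> (I \<union> (?C - I)))"
  proof (intro inj_on_UnI)
    show "inj_on g D" using f(1) gD by (simp cong: inj_on_cong)
    show "inj_on g I" using h(1) inj_on_cong[of I g h, OF gI(2)] by blast
    show "inj_on g (?C - I)" using a(1) inj_on_cong[of "?C - I" g a, OF gC(3)] by blast
    show "g ` I \<inter> g ` (?C - I) = {}" using gim(1,2) core(5) by blast
    show "g ` D \<inter> g ` (I \<union> (?C - I)) = {}"
    proof -
      have "g ` D = f ` D" using gD by simp
      moreover have "f ` D \<inter> g ` I = {}" using gim(1) f(3) by blast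
      moreover have "f ` D \<inter> g ` (?C - I) = {}" using gim(3) by blast
      ultimately show ?thesis unfolding image_Un Int_Un_distrib by simp
    qed
  qed
  moreover have "D \<union> (I \<union> (?C - I)) = U'" using IC U' by blast
  ultimately have injg: "inj_on g U'" by simp
  moreover have "g ` U' \<subseteq> V"
  proof
    fix v assume "v \<in> g ` U'"
    then obtain x where "v = g x" "x \<in> U'" by blast
    then show "v \<in> V"
      using gD[of x] gI(1)[of x] gC(1)[of x] f(2) core(1,2) by (cases "x \<in> D"; cases "x \<in> I") auto
  qed
  moreover have "adj (g x) (g y)" if xy: "x \<in> U'" "y \<in> U'" "t x y" for x y
  proof -
    have inj: "g x \<noteq> g y"
      using inj_onD[OF injg _ xy(1,2)] t_col[OF xy(3)] by auto
    \<comment> \<open>Every tree edge with an end outside \<open>D\<close> is mapped with an end in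
      \<open>A\<close>: neighbours in \<open>D\<close> of such a vertex go to \<open>A\<close>, and
      \<open>I\<close> is independent.\<close>
    have key: "adj (g x) (g y)" if h: "x \<in> U' - D" "y \<in> U'" "t x y" "g x \<noteq> g y" for x y
    proof -
      have x: "x \<in> I \<and> g x \<in> Y \<or> g x \<in> A" using gI(1)[of x] gC(1)[of x] h(1) by blast
      consider "y \<in> D" | "y \<in> I" | "y \<in> ?C - I" using h(2) by blast
      then show ?thesis
      proof cases
        case 1
        then have "g y \<in> A" using f(5)[OF 1 h(1)] t_sym[OF h(3)] gD by simp
        then show ?thesis
          using x h(4) core(6,8) by auto
      next
        case 2
        then have "g x \<in> A" using J(3) I(1) h(3) x by blast
        then show ?thesis using gI(1)[OF 2] x core(7) by blast
      next
        case 3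
        then show ?thesis
          using gC(1)[OF 3] x h(4) core(6,8) by auto
      qed
    qed
    show ?thesis
    proof (cases "x \<in> D")
      case xD: True
      show ?thesis
      proof (cases "y \<in> D")
        case True
        then show ?thesis using f(4) xD xy gD by simp
      next
        case False
        then show ?thesis using key[of y x] xy inj t_sym adj_sym by auto
      qed
    next
      case False
      then show ?thesis using key xy inj by auto
    qed
  qed
  ultimately show ?thesis using gD by (intro exI[of _ g]) blast
qed

text \<open>With the \<open>b\<close> leaves outside the core and their parents in \<open>A\<close>,
  the other \<open>n - b\<close> vertices, parents included, fill the core exactly. The leaves
  impose no further conditions, their parents being their only neighbours.\<close>

lemma star_embedding:
  assumes c: "core A Y b" and X: "X \<subseteq> leaves" "card X = b"
    and f: "inj_on f (parent ` X)" "f ` parent ` X \<subseteq> A"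
    and g: "inj_on g X" "g ` X \<subseteq> V - (A \<union> Y)"
    and fg: "\<And>x. x \<in> X \<Longrightarrow> adj (f (parent x)) (g x)"
  shows False
proof -
  note core = coreD[OF c]
  have finX: "finite X" using X finite_U finite_subset by (metis leaves_def mem_Collect_eq subsetI)
  let ?P = "parent ` X"
  define h where "h x = (if x \<in> X then g x else f x)" for x
  have PX: "?P \<inter> X = {}" using leafD(6) X by blast
  have hP: "h x = f x" if "x \<in> ?P" for x using that PX by (auto simp: h_def)
  have hX: "h x = g x" if "x \<in> X" for x using that by (simp add: h_def)
  have im: "h ` (X \<union> ?P) = g ` X \<union> f ` ?P" using hP hX by (simp add: image_Un)
  have XU: "X \<subseteq> U" "?P \<subseteq> U" using X leafD(1,2) by auto
  have only: "y = parent x" if "x \<in> X" "y \<in> U" "t x y" for x y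
    using leafD(5)[of x y] X that by blast
  have cD: "card (X \<union> ?P) = b + card ?P" using PX finX X(2) by (subst card_Un_disjoint) auto
  have cP: "card ?P \<le> b" using card_image_le[OF finX] X(2) by simp
  have cU: "card (U - (X \<union> ?P)) + (b + card ?P) = n"
    using XU finite_U finX cD card_U card_mono[of U "X \<union> ?P"] by (simp add: card_Diff_subset)
  have Aeq: "A - h ` (X \<union> ?P) = A - f ` ?P" unfolding im using g(2) by blast
  have cA: "card (A - f ` ?P) + card ?P = card A"
    using f finX core(3) card_mono[of A "f ` ?P"] by (simp add: card_Diff_subset card_image)
  have "\<exists>h'. inj_on h' U \<and> h' ` U \<subseteq> V \<and> (\<forall>x\<in>X \<union> ?P. h' x = h x) \<and>
    (\<forall>x\<in>U. \<forall>y\<in>U. t x y \<longrightarrow> adj (h' x) (h' y))"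
  proof (rule extend_embedding[OF c])
    have "inj_on h X" "inj_on h ?P" using f(1) g(1) hX hP by (simp_all cong: inj_on_cong)
    moreover have "h ` X \<inter> h ` ?P = {}" using f(2) g(2) hX hP by auto
    ultimately show "inj_on h (X \<union> ?P)" by (rule inj_on_UnI)
    show "h ` (X \<union> ?P) \<subseteq> V" "h ` (X \<union> ?P) \<inter> Y = {}"
      unfolding im using f(2) g(2) core(1,5) by blast+
    show "X \<union> ?P \<subseteq> U" using XU by blast
    show "adj (h x) (h y)" if xy: "x \<in> X \<union> ?P" "y \<in> X \<union> ?P" "t x y" for x y
    proof -
      consider "x \<in> X" | "y \<in> X" "x \<in> ?P" | "x \<in> ?P" "y \<in> ?P" using xy by blast
      then show ?thesis
      proof cases
        case 1
        then have "y = parent x" using only xy XU by blast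
        then show ?thesis using 1 hX[OF 1] hP[of y] fg[OF 1] adj_sym by auto
      next
        case 2
        then have "x = parent y" using only[of y x] xy XU t_sym by blast
        then show ?thesis using 2 hX[OF 2(1)] hP[OF 2(2)] fg[OF 2(1)] by auto
      next
        case 3
        then have "f x \<in> A" "f y \<in> A" using f(2) by auto
        moreover have "f x \<noteq> f y" using inj_onD[OF f(1) _ 3] t_col[OF xy(3)] by auto
        ultimately show ?thesis using core(6) hP[OF 3(1)] hP[OF 3(2)] by auto
      qed
    qed
    show "h x \<in> A" if "x \<in> X \<union> ?P" "y \<in> U - (X \<union> ?P)" "t x y" for x y
      using that only[of x y] hP[of x] f(2) by blast
    show "card (U - (X \<union> ?P)) \<le> card (A - h ` (X \<union> ?P)) + card Y"
      unfolding Aeq using cU cA core(9) by linarith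
    show "card (U - (X \<union> ?P)) \<le> 2 * card (A - h ` (X \<union> ?P))"
      unfolding Aeq using cU cA cP core(11,12) n_ge k_sq by linarith
  qed simp
  then obtain h' where "inj_on h' U" "h' ` U \<subseteq> V" "\<forall>x\<in>U. \<forall>y\<in>U. t x y \<longrightarrow> adj (h' x) (h' y)"
    by auto
  then show False using no_embedding unfolding embeds_def by blast
qed

text \<open>The analogue for vertices of degree 2: the outside vertex \<open>g x\<close> sees
  \<open>p x\<close> and \<open>q x\<close> in \<open>A\<close>, which host the two tree neighbours
  of \<open>x\<close>.\<close>

lemma cherry_embedding:
  assumes c: "core A Y b" and X: "X \<subseteq> U" "card X = b" "\<And>x y. x \<in> X \<Longrightarrow> y \<in> X \<Longrightarrow> \<not> t x y"
    and lr: "\<And>x. x \<in> X \<Longrightarrow> {y \<in> U. t x y} = {l x, r x}" "inj_on l X" "inj_on r X" "l ` X \<inter> r ` X = {}"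
    and g: "inj_on g X" "g ` X \<subseteq> V - (A \<union> Y)"
    and pq: "inj_on p X" "inj_on q X" "p ` X \<inter> q ` X = {}" "p ` X \<subseteq> A" "q ` X \<subseteq> A"
      "\<And>x. x \<in> X \<Longrightarrow> adj (g x) (p x) \<and> adj (g x) (q x)"
  shows False
proof -
  note core = coreD[OF c]
  have finX: "finite X" using X finite_U finite_subset by blast
  let ?N = "l ` X \<union> r ` X"
  \<comment> \<open>As \<open>l\<close> and \<open>r\<close> are injective on \<open>X\<close> with
    disjoint images, each tree neighbour of \<open>X\<close> determines its host.\<close>
  define h where "h z = (if z \<in> X then g z else if z \<in> l ` X then p (inv_into X l z) else q (inv_into X r z))" for z
  have tl: "t x (l x)" "t x (r x)" "l x \<in> U" "r x \<in> U" if "x \<in> X" for x using lr(1)[OF that] by auto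
  have NX: "?N \<inter> X = {}" using X(3) tl(1,2) by blast
  have hX: "h x = g x" if "x \<in> X" for x using that by (simp add: h_def)
  have hl: "h (l x) = p x" if "x \<in> X" for x
    using that NX inv_into_f_f[OF lr(2) that] by (auto simp: h_def)
  have hr: "h (r x) = q x" if "x \<in> X" for x
    using that NX lr(4) inv_into_f_f[OF lr(3) that] by (auto simp: h_def)
  have imN: "h ` ?N = p ` X \<union> q ` X" using hl hr by (simp add: image_Un image_image)
  have NA: "h ` ?N \<subseteq> A" unfolding imN using pq(4,5) by blast
  have im: "h ` (X \<union> ?N) = g ` X \<union> (p ` X \<union> q ` X)"
    using imN hX by (metis image_Un image_cong)
  have XU: "?N \<subseteq> U" using tl by blast
  have only: "y \<in> ?N" "adj (h x) (h y)" if "x \<in> X" "y \<in> U" "t x y" for x y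
  proof -
    have "y = l x \<or> y = r x" using lr(1)[OF that(1)] that(2,3) by blast
    then show "y \<in> ?N" "adj (h x) (h y)"
      using that(1) pq(6)[OF that(1)] hX[OF that(1)] hl[OF that(1)] hr[OF that(1)] by auto
  qed
  have injN: "inj_on h ?N"
  proof (rule inj_on_UnI)
    show "inj_on h (l ` X)" "inj_on h (r ` X)"
      using pq(1,2) hl hr by (auto simp: inj_on_def)
    show "h ` l ` X \<inter> h ` r ` X = {}" using pq(3) hl hr by (simp add: image_image)
  qed
  have cN: "card ?N = 2 * b"
    using lr(2-4) finX X(2) by (simp add: card_Un_disjoint card_image)
  have cD: "card (X \<union> ?N) = 3 * b" using NX finX X(2) cN by (subst card_Un_disjoint) auto
  have cU: "card (U - (X \<union> ?N)) + 3 * b = n"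
    using XU X(1) finite_U finX cD card_U card_mono[of U "X \<union> ?N"] by (simp add: card_Diff_subset)
  have Aeq: "A - h ` (X \<union> ?N) = A - h ` ?N" unfolding im imN using g(2) by blast
  have cA: "card (A - h ` ?N) + 2 * b = card A"
    using NA finX core(3) card_mono[of A "h ` ?N"] cN card_image[OF injN] by (simp add: card_Diff_subset)
  have "\<exists>h'. inj_on h' U \<and> h' ` U \<subseteq> V \<and> (\<forall>x\<in>X \<union> ?N. h' x = h x) \<and>
    (\<forall>x\<in>U. \<forall>y\<in>U. t x y \<longrightarrow> adj (h' x) (h' y))"
  proof (rule extend_embedding[OF c])
    have "inj_on h X" using g(1) hX by (simp cong: inj_on_cong)
    moreover have "h ` X \<inter> h ` ?N = {}" using NA g(2) hX by auto
    ultimately show "inj_on h (X \<union> ?N)" using inj_on_UnI[OF _ injN] by blast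
    show "h ` (X \<union> ?N) \<subseteq> V" "h ` (X \<union> ?N) \<inter> Y = {}"
      unfolding im using pq(4,5) g(2) core(1,5) by blast+
    show "X \<union> ?N \<subseteq> U" using XU X(1) by blast
    show "adj (h x) (h y)" if xy: "x \<in> X \<union> ?N" "y \<in> X \<union> ?N" "t x y" for x y
    proof -
      consider "x \<in> X" | "y \<in> X" | "x \<in> ?N" "y \<in> ?N" using xy by blast
      then show ?thesis
      proof cases
        case 1
        then show ?thesis using only(2)[of x y] xy XU X(1) by blast
      next
        case 2
        then show ?thesis using only(2)[of y x] xy XU X(1) t_sym adj_sym by blast
      next
        case 3
        then have "h x \<in> A" "h y \<in> A" using NA by auto
        moreover have "h x \<noteq> h y" using inj_onD[OF injN _ 3] t_col[OF xy(3)] by auto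
        ultimately show ?thesis using core(6) by auto
      qed
    qed
    show "h x \<in> A" if "x \<in> X \<union> ?N" "y \<in> U - (X \<union> ?N)" "t x y" for x y
      using that only(1)[of x y] NA by blast
    show "card (U - (X \<union> ?N)) \<le> card (A - h ` (X \<union> ?N)) + card Y"
      unfolding Aeq using cU cA core(9) by linarith
    show "card (U - (X \<union> ?N)) \<le> 2 * card (A - h ` (X \<union> ?N))"
      unfolding Aeq using cU cA core(11,12) n_ge k_sq by linarith
  qed simp
  then obtain h' where "inj_on h' U" "h' ` U \<subseteq> V" "\<forall>x\<in>U. \<forall>y\<in>U. t x y \<longrightarrow> adj (h' x) (h' y)"
    by auto
  then show False using no_embedding unfolding embeds_def by blast
qed

end

section \<open>Attaching leaves and vertices of degree two\<close>

context tree_free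
begin

section \<open>Choosing the tree vertices to attach\<close>

lemma finite_leaves: "finite leaves"
  using finite_U by (simp add: leaves_def)

text \<open>Take a largest balanced \<open>X\<close>. If it has fewer than \<open>k\<close> leaves,
  all leaves outside it belong to one star with at least \<open>k / 2\<close> leaves in
  \<open>X\<close>. As that star has fewer than \<open>k\<close> leaves, the total is at most
  \<open>3 * k / 2 - 2\<close>.\<close>

lemma obtain_spread_leaves:
  assumes small: "\<And>p. card {x \<in> leaves. parent x = p} < k" and many: "3 * k < 2 * card leaves + 4"
  shows "\<exists>X\<subseteq>leaves. card X = k \<and> (\<forall>p. 2 * card {x \<in> X. parent x = p} \<le> k + 1)"
proof -
  define ok where "ok X \<longleftrightarrow> X \<subseteq> leaves \<and> (\<forall>p. 2 * card {x \<in> X. parent x = p} \<le> k + 1)" for X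
  have "ok {}" by (simp add: ok_def)
  moreover have "\<forall>X. ok X \<longrightarrow> card X < Suc (card leaves)"
    using finite_leaves by (auto simp: ok_def less_Suc_eq_le card_mono)
  ultimately obtain X where X: "ok X" and max: "\<And>X'. ok X' \<Longrightarrow> card X' \<le> card X"
    using ex_has_greatest_nat[of ok "{}" card "Suc (card leaves)"] by (metis less_imp_le)
  have XL: "X \<subseteq> leaves" using X by (simp add: ok_def)
  have finX: "finite X" using XL finite_leaves finite_subset by blast
  have "k \<le> card X"
  proof (rule ccontr)
    assume "\<not> k \<le> card X"
    then have cX: "card X < k" by simp
    \<comment> \<open>Adding \<open>l\<close> would violate the balance condition, so its star
      already has at least half of \<open>k\<close> leaves in \<open>X\<close>.\<close>
    have full: "k \<le> 2 * card {x \<in> X. parent x = parent l}" if l: "l \<in> leaves - X" for l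
    proof (rule ccontr)
      assume nf: "\<not> ?thesis"
      have "2 * card {x \<in> insert l X. parent x = p} \<le> k + 1" for p
      proof (cases "p = parent l")
        case True
        then have "{x \<in> insert l X. parent x = p} = insert l {x \<in> X. parent x = parent l}" by auto
        then show ?thesis using nf finX l by simp
      next
        case False
        then have "{x \<in> insert l X. parent x = p} = {x \<in> X. parent x = p}" by auto
        then show ?thesis using X by (simp add: ok_def)
      qed
      then have "ok (insert l X)" using XL l by (simp add: ok_def)
      then show False using max[of "insert l X"] finX l by simp
    qed
    show False
    proof (cases "leaves \<subseteq> X")
      case True
      then have "card leaves < k" using cX card_mono[OF finX True] by linarith
      then show False using many k_ge by linarith
    next
      case False
      then obtain l where l: "l \<in> leaves - X" by blast
      let ?F = "\<lambda>p. {x \<in> X. parent x = p}"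
      \<comment> \<open>Two such stars would already give \<open>X\<close> at least \<open>k\<close>
        leaves.\<close>
      have same: "parent l' = parent l" if l': "l' \<in> leaves - X" for l'
      proof (rule ccontr)
        assume "parent l' \<noteq> parent l"
        then have "card (?F (parent l')) + card (?F (parent l)) = card (?F (parent l') \<union> ?F (parent l))"
          using finX by (intro card_Un_disjoint[symmetric]) auto
        also have "\<dots> \<le> card X" using finX by (intro card_mono) auto
        finally show False using full[OF l] full[OF l'] cX by linarith
      qed
      have "(leaves - X) \<union> ?F (parent l) \<subseteq> {x \<in> leaves. parent x = parent l}" using same XL by blast
      then have "card ((leaves - X) \<union> ?F (parent l)) \<le> card {x \<in> leaves. parent x = parent l}"
        using finite_leaves by (intro card_mono) auto
      then have "card ((leaves - X) \<union> ?F (parent l)) < k" using small[of "parent l"] by linarith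
      moreover have "card ((leaves - X) \<union> ?F (parent l)) = card (leaves - X) + card (?F (parent l))"
        using finX finite_leaves by (intro card_Un_disjoint) auto
      moreover have "card leaves = card (leaves - X) + card X"
        using XL finX card_mono[OF finite_leaves XL] by (simp add: card_Diff_subset)
      ultimately show False using full[OF l] cX many by linarith
    qed
  qed
  then obtain X' where X': "X' \<subseteq> X" "card X' = k" by (rule obtain_subset_with_card_n)
  have "2 * card {x \<in> X'. parent x = p} \<le> k + 1" for p
  proof -
    have "card {x \<in> X'. parent x = p} \<le> card {x \<in> X. parent x = p}"
      using finX X'(1) by (intro card_mono) auto
    moreover have "2 * card {x \<in> X. parent x = p} \<le> k + 1" using X by (simp add: ok_def)
    ultimately show ?thesis by linarith
  qed
  then show ?thesis using X' XL by blast
qed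

text \<open>Few leaves mean little excess degree, so almost all vertices have degree 2. For a
  largest admissible family \<open>X\<close>, all of these lie within distance two of
  \<open>X\<close>, which bounds their number by \<open>6 * card X\<close> plus the excess: too few
  when \<open>card X < k\<close>.\<close>

lemma obtain_slots:
  assumes few: "2 * card leaves + 4 \<le> 3 * k"
  shows "\<exists>X\<subseteq>U. card X = k \<and> (\<forall>x\<in>X. deg x = 2) \<and> (\<forall>x\<in>X. \<forall>y\<in>X. \<not> t x y) \<and>
    (\<forall>x\<in>X. \<forall>y\<in>X. x \<noteq> y \<longrightarrow> {z \<in> U. t x z} \<inter> {z \<in> U. t y z} = {})"
proof -
  let ?n = "\<lambda>x. {z \<in> U. t x z}"
  have fin_n: "finite (?n x)" for x using finite_U by simp
  let ?D = "{x \<in> U. deg x = 2}" and ?B = "{x \<in> U. 2 < deg x}"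
  \<comment> \<open>The excess over 2; truncated subtraction makes it 0 at leaves, whose deficit 1
    is counted separately.\<close>
  define e where "e x = deg x - 2" for x
  have dpos: "0 < deg x" if "x \<in> U" for x using degree_pos[OF that] by (simp add: deg_def)
  have "(\<Sum>x\<in>U. deg x + (if x \<in> leaves then 1 else 0)) = (\<Sum>x\<in>U. 2 + e x)"
  proof (rule sum.cong)
    fix x assume "x \<in> U"
    then show "deg x + (if x \<in> leaves then 1 else 0) = 2 + e x"
      using dpos[of x] by (auto simp: e_def leaves_def)
  qed simp
  moreover have "(\<Sum>x\<in>U. if x \<in> leaves then 1 else 0) = card leaves"
  proof -
    have "U \<inter> leaves = leaves" by (auto simp: leaves_def)
    then show ?thesis using finite_U by (simp add: sum.If_cases)
  qed
  moreover have "(\<Sum>x\<in>U. 2 + e x) = 2 * n + sum e U"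
    using card_U by (simp only: sum.distrib sum_constant) simp
  ultimately have se: "sum e U + 2 = card leaves"
    using degree_sum card_U unfolding sum.distrib deg_def by linarith
  have cB: "card ?B \<le> sum e U"
  proof -
    have "card ?B = (\<Sum>x\<in>?B. 1)" by simp
    also have "\<dots> \<le> sum e ?B" by (intro sum_mono) (auto simp: e_def)
    also have "\<dots> \<le> sum e U" using finite_U by (intro sum_mono2) auto
    finally show ?thesis .
  qed
  have "card U = card (leaves \<union> (?D \<union> ?B))"
  proof (rule arg_cong[of _ _ card], intro equalityI subsetI)
    fix x assume "x \<in> U"
    then show "x \<in> leaves \<union> (?D \<union> ?B)" using dpos[of x] by (auto simp: leaves_def)
  qed (auto simp: leaves_def)
  also have "\<dots> \<le> card leaves + (card ?D + card ?B)"
    using card_Un_le[of leaves "?D \<union> ?B"] card_Un_le[of ?D ?B] by linarith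
  finally have cU: "n \<le> card leaves + (card ?D + card ?B)" using card_U by simp
  define ok where "ok X \<longleftrightarrow> X \<subseteq> ?D \<and> (\<forall>x\<in>X. \<forall>y\<in>X. \<not> t x y) \<and>
    (\<forall>x\<in>X. \<forall>y\<in>X. x \<noteq> y \<longrightarrow> ?n x \<inter> ?n y = {})" for X
  have "ok {}" by (simp add: ok_def)
  moreover have "\<forall>X. ok X \<longrightarrow> card X < Suc (card ?D)"
    using finite_U by (auto simp: ok_def less_Suc_eq_le intro!: card_mono)
  ultimately obtain X where X: "ok X" and max: "\<And>X'. ok X' \<Longrightarrow> card X' \<le> card X"
    using ex_has_greatest_nat[of ok "{}" card "Suc (card ?D)"] by (metis less_imp_le)
  have XD: "X \<subseteq> ?D" using X by (simp add: ok_def)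
  have finX: "finite X" by (rule finite_subset[OF XD]) (simp add: finite_U)
  have "k \<le> card X"
  proof (rule ccontr)
    assume "\<not> k \<le> card X"
    then have cX: "card X + 1 \<le> k" by simp
    define N where "N = (\<Union>x\<in>X. ?n x)"
    have finN: "finite N" using finX fin_n by (simp add: N_def)
    have "card N \<le> (\<Sum>x\<in>X. card (?n x))" unfolding N_def using finX by (rule card_UN_le)
    also have "\<dots> = (\<Sum>x\<in>X. 2)" using XD by (intro sum.cong) (auto simp: deg_def)
    finally have cN: "card N \<le> 2 * card X" by simp
    have "card (\<Union>w\<in>N. ?n w) \<le> (\<Sum>w\<in>N. card (?n w))" using finN by (rule card_UN_le)
    also have "\<dots> \<le> (\<Sum>w\<in>N. 2 + e w)" by (intro sum_mono) (auto simp: deg_def e_def)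
    also have "\<dots> = 2 * card N + sum e N" by (simp only: sum.distrib sum_constant) simp
    also have "\<dots> \<le> 2 * card N + sum e U"
      using finite_U sum_mono2[of U N e] by (auto simp: N_def)
    finally have cN2: "card (\<Union>w\<in>N. ?n w) \<le> 2 * card N + sum e U" by simp
    have "?D \<subseteq> N \<union> (\<Union>w\<in>N. ?n w)"
    proof
      fix d assume d: "d \<in> ?D"
      then have dU: "d \<in> U" by simp
      show "d \<in> N \<union> (\<Union>w\<in>N. ?n w)"
      proof (cases "d \<in> X")
        case True
        have "?n d \<noteq> {}" using dpos[OF dU] unfolding deg_def by (metis card.empty less_irrefl)
        then obtain w where "w \<in> U" "t d w" by blast
        then have "w \<in> N" "d \<in> ?n w" using True dU t_sym by (auto simp: N_def)
        then show ?thesis by blast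
      next
        case False
        have nok: "\<not> ok (insert d X)" using max[of "insert d X"] finX False by auto
        have tdd: "\<not> t d d" using t_col by blast
        have "\<exists>x\<in>X. t d x \<or> t x d \<or> ?n d \<inter> ?n x \<noteq> {}"
        proof (rule ccontr)
          assume no: "\<not> ?thesis"
          have no1: "\<not> t d x" "\<not> t x d" "?n d \<inter> ?n x = {}" "?n x \<inter> ?n d = {}" if "x \<in> X" for x
            using no that by auto
          have X1: "\<not> t x y" if "x \<in> X" "y \<in> X" for x y using X that by (simp add: ok_def)
          have X2: "?n x \<inter> ?n y = {}" if "x \<in> X" "y \<in> X" "x \<noteq> y" for x y using X that by (simp add: ok_def)
          have "ok (insert d X)"
            unfolding ok_def
          proof (intro conjI ballI impI)
            show "insert d X \<subseteq> ?D" using XD d by simp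
            fix x y assume xy: "x \<in> insert d X" "y \<in> insert d X"
            show "\<not> t x y" using xy no1(1,2) X1 tdd by (cases "x = d"; cases "y = d") auto
            assume "x \<noteq> y"
            then show "?n x \<inter> ?n y = {}"
              using xy no1(3)[of y] no1(4)[of x] X2[of x y] by (cases "x = d"; cases "y = d") auto
          qed
          then show False using nok by blast
        qed
        then obtain x where x: "x \<in> X" "t d x \<or> t x d \<or> ?n d \<inter> ?n x \<noteq> {}" by blast
        then consider "t x d" | z where "z \<in> U" "t d z" "t x z" using t_sym by blast
        then show ?thesis
        proof cases
          case 1
          then show ?thesis using x(1) dU by (auto simp: N_def)
        next
          case 2
          then have "z \<in> N" "d \<in> ?n z" using x(1) dU t_sym by (auto simp: N_def)
          then show ?thesis by blast
        qed
      qed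
    qed
    then have "card ?D \<le> card (N \<union> (\<Union>w\<in>N. ?n w))" using finN fin_n by (intro card_mono) auto
    also have "\<dots> \<le> card N + card (\<Union>w\<in>N. ?n w)" by (rule card_Un_le)
    finally have "card ?D \<le> 6 * card X + sum e U" using cN cN2 by linarith
    then have "2 * n + 32 \<le> 21 * k" using cU cB se few cX by linarith
    \<comment> \<open>The difference of the two sides is \<open>(2 * k - 3) * (k - 8)\<close>, so
      \<open>8 \<le> k\<close> is just enough.\<close>
    moreover have "19 * k \<le> 2 * (k * k) + 24"
    proof -
      obtain j where "k = 8 + j" using k_ge le_Suc_ex by blast
      then show ?thesis by (simp add: algebra_simps)
    qed
    ultimately show False using n_ge by linarith
  qed
  then obtain X' where X': "X' \<subseteq> X" "card X' = k" by (rule obtain_subset_with_card_n)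
  show ?thesis
  proof (intro exI[of _ X'] conjI)
    show "X' \<subseteq> U" "\<forall>x\<in>X'. deg x = 2" using X'(1) XD by auto
    show "\<forall>x\<in>X'. \<forall>y\<in>X'. \<not> t x y" "\<forall>x\<in>X'. \<forall>y\<in>X'. x \<noteq> y \<longrightarrow> ?n x \<inter> ?n y = {}"
      using X'(1) X unfolding ok_def by (meson subsetD)+
  qed (rule X'(2))
qed

section \<open>Failed attachments and the second core\<close>

lemma initial_core: "\<exists>A Y b. core A Y b"
proof -
  obtain v where "v \<in> V" "n \<le> card (nonnbrs adj v V)" using sparse_vertex by blast
  then show ?thesis using core_exists_nonnbrs[OF _ subset_refl] by blast
qed

lemma card_outside:
  assumes "core A Y b"
  shows "card (V - (A \<union> Y)) + 1 = n + b"
proof -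
  note core = coreD[OF assms]
  have "card (A \<union> Y) + b = n" using core by (simp add: card_Un_disjoint)
  moreover have "card (V - (A \<union> Y)) + card (A \<union> Y) = card V"
    using core(1,2) finite_V card_mono[of V "A \<union> Y"] core(3,4) by (simp add: card_Diff_subset)
  ultimately show ?thesis using card_V by linarith
qed

text \<open>When the star system gets stuck at a star with \<open>c\<close> leaves, at least
  \<open>c\<close> of the chosen outside vertices are free, and every free vertex of
  \<open>A0\<close> misses one of any \<open>c\<close> of them. So at most \<open>c * h\<close>
  vertices of \<open>A0\<close> are free, against \<open>size\<close>.\<close>

lemma attach_stars:
  assumes c: "core A Y b" and X: "X \<subseteq> leaves" "card X = b"
    and A0: "A0 \<subseteq> A" and W: "W \<subseteq> V - (A \<union> Y)" "b \<le> card W"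
    and h: "\<And>y. y \<in> W \<Longrightarrow> card (nonnbrs adj y A0) \<le> h"
    and size: "\<And>p. p \<in> parent ` X \<Longrightarrow> card {x \<in> X. parent x = p} * h + b < card A0 + card {x \<in> X. parent x = p}"
  shows False
proof -
  have finX: "finite X" using X(1) finite_leaves finite_subset by blast
  have finA0: "finite A0" using A0 coreD(3)[OF c] finite_subset by blast
  obtain W' where W': "W' \<subseteq> W" "card W' = b" "finite W'" by (rule obtain_subset_with_card_n[OF W(2)])
  consider (full) f g where "inj_on f (parent ` X)" "f ` parent ` X \<subseteq> A0" "inj_on g X" "g ` X \<subseteq> W'"
      "\<forall>x\<in>X. adj (f (parent x)) (g x)"
    | (fail) A1 W1 p where "A1 \<subseteq> A0" "finite A1" "W1 \<subseteq> W'" "p \<in> parent ` X"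
        "card A1 + card {x \<in> X. parent x = p} \<le> card X"
        "card W1 + card {x \<in> X. parent x = p} \<le> card X"
        "\<forall>a\<in>A0 - A1. card {y \<in> W' - W1. adj a y} < card {x \<in> X. parent x = p}"
    by (rule star_system_cases[OF finX W'(3), of parent A0 adj])
  then show False
  proof cases
    case full
    show False
    proof (rule star_embedding[OF c X full(1) _ full(3)])
      show "f ` parent ` X \<subseteq> A" using full(2) A0 by blast
      show "g ` X \<subseteq> V - (A \<union> Y)" using full(4) W'(1) W(1) by blast
      show "\<And>x. x \<in> X \<Longrightarrow> adj (f (parent x)) (g x)" using full(5) by blast
    qed
  next
    case fail
    let ?c = "card {x \<in> X. parent x = p}"
    have "card (W' - W1) = b - card W1"
      using fail(3) W'(2,3) card_Diff_subset finite_subset by metis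
    then have "?c \<le> card (W' - W1)" using fail(6) X(2) by linarith
    then obtain C where C: "C \<subseteq> W' - W1" "card C = ?c" "finite C" by (rule obtain_subset_with_card_n)
    have "A0 - A1 \<subseteq> (\<Union>y\<in>C. nonnbrs adj y A0)"
    proof
      fix a assume a: "a \<in> A0 - A1"
      have "\<not> C \<subseteq> {y \<in> W' - W1. adj a y}"
      proof
        assume "C \<subseteq> {y \<in> W' - W1. adj a y}"
        then have "?c \<le> card {y \<in> W' - W1. adj a y}" using C(2) W'(3) card_mono[of "{y \<in> W' - W1. adj a y}" C] by simp
        then show False using bspec[OF fail(7) a] by linarith
      qed
      then obtain y where y: "y \<in> C" "\<not> adj a y" using C(1) by blast
      have "y \<noteq> a" using y(1) C(1) W'(1) W(1) a A0 by blast
      then have "a \<in> nonnbrs adj y A0" using y a adj_sym by (auto simp: nonnbrs_def)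
      then show "a \<in> (\<Union>y\<in>C. nonnbrs adj y A0)" using y(1) by blast
    qed
    then have "card (A0 - A1) \<le> card (\<Union>y\<in>C. nonnbrs adj y A0)"
      using C(3) finA0 by (intro card_mono) (auto simp: nonnbrs_def)
    also have "\<dots> \<le> (\<Sum>y\<in>C. card (nonnbrs adj y A0))" using C(3) by (rule card_UN_le)
    also have "\<dots> \<le> (\<Sum>y\<in>C. h)" using h C(1) W'(1) by (intro sum_mono) blast
    also have "\<dots> = ?c * h" using C(2) by simp
    finally have "card A0 \<le> ?c * h + card A1"
      using card_Diff_subset[OF fail(2,1)] by linarith
    then show False using fail(5) size[OF fail(4)] X(2) by linarith
  qed
qed

text \<open>The stars of \<open>X\<close> cannot all be attached, by \<open>star_embedding\<close>.
  Deleting the vertices used when the star system gets stuck leaves large sets \<open>A0\<close> and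
  \<open>Q\<close> with very few edges between them.\<close>

lemma bottleneck:
  assumes c: "core A Y b" and X: "X \<subseteq> leaves" "card X = b"
  shows "\<exists>A0 Q p. A0 \<subseteq> A \<and> Q \<subseteq> V - (A \<union> Y) \<and> p \<in> parent ` X \<and>
    card A + card {x \<in> X. parent x = p} \<le> card A0 + b \<and>
    n + card {x \<in> X. parent x = p} \<le> card Q + 1 \<and>
    (\<forall>a\<in>A0. card (nbrs adj a Q) < card {x \<in> X. parent x = p})"
proof -
  have finX: "finite X" using X(1) finite_leaves finite_subset by blast
  let ?W = "V - (A \<union> Y)"
  have finW: "finite ?W" using finite_V by simp
  consider (full) f g where "inj_on f (parent ` X)" "f ` parent ` X \<subseteq> A" "inj_on g X" "g ` X \<subseteq> ?W"
      "\<forall>x\<in>X. adj (f (parent x)) (g x)"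
    | (fail) A1 W1 p where "A1 \<subseteq> A" "finite A1" "W1 \<subseteq> ?W" "p \<in> parent ` X"
        "card A1 + card {x \<in> X. parent x = p} \<le> card X"
        "card W1 + card {x \<in> X. parent x = p} \<le> card X"
        "\<forall>a\<in>A - A1. card {y \<in> ?W - W1. adj a y} < card {x \<in> X. parent x = p}"
    by (rule star_system_cases[OF finX finW, of parent A adj])
  then show ?thesis
  proof cases
    case full
    then have False using star_embedding[OF c X full(1,2,3,4)] by blast
    then show ?thesis ..
  next
    case fail
    have W1: "finite W1" using fail(3) finW finite_subset by blast
    have "nbrs adj a (?W - W1) = {y \<in> ?W - W1. adj a y}" if "a \<in> A" for a
      using that by (auto simp: nbrs_def)
    then have "\<forall>a\<in>A - A1. card (nbrs adj a (?W - W1)) < card {x \<in> X. parent x = p}"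
      using fail(7) by simp
    moreover have "card A + card {x \<in> X. parent x = p} \<le> card (A - A1) + b"
      using card_Diff_subset[OF fail(2,1)] fail(5) X(2) card_mono[OF coreD(3)[OF c] fail(1)] by linarith
    moreover have "n + card {x \<in> X. parent x = p} \<le> card (?W - W1) + 1"
      using card_Diff_subset[OF W1 fail(3)] fail(6) X(2) card_outside[OF c] card_mono[OF finW fail(3)] by linarith
    ultimately show ?thesis
      using fail(4) by (intro exI[of _ "A - A1"] exI[of _ "?W - W1"] exI[of _ p]) blast
  qed
qed

text \<open>At least \<open>n\<close> vertices of \<open>Q\<close> are non-neighbours of
  \<open>a\<close>, and these contain a core.\<close>

lemma second_core:
  assumes "a \<in> V" "Q \<subseteq> V" "a \<notin> Q" "card (nbrs adj a Q) < c" "n + c \<le> card Q + 1"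
  shows "\<exists>A' Y' b'. core A' Y' b' \<and> A' \<union> Y' \<subseteq> Q"
proof -
  have "finite Q" using assms(2) finite_V finite_subset by blast
  then have "n \<le> card (nonnbrs adj a Q)"
    using card_nbrs_nonnbrs[of Q a adj] assms(3-5) by linarith
  moreover have "nonnbrs adj a Q \<subseteq> nonnbrs adj a V" using assms(2) by (auto simp: nonnbrs_def)
  ultimately obtain A' Y' b' where "core A' Y' b'" "A' \<union> Y' \<subseteq> nonnbrs adj a Q"
    using core_exists_nonnbrs[OF assms(1)] by blast
  then show ?thesis by (metis (no_types, lifting) mem_Collect_eq nonnbrs_def subset_iff)
qed

text \<open>If both bounds failed, each non-neighbour of \<open>y\<close> in \<open>A0\<close> would
  miss more than \<open>k\<close> of the at least \<open>k + c\<close> non-neighbours of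
  \<open>y\<close> in \<open>B\<close>, giving a fan with centre \<open>y\<close> through
  \<open>bipartite_fan\<close>.\<close>

lemma few_nonnbrs_dichotomy:
  assumes "y \<in> V" "A0 \<subseteq> V" "Q \<subseteq> V" "A0 \<inter> Q = {}" "B \<subseteq> Q"
    and c: "\<And>a. a \<in> A0 \<Longrightarrow> card (nbrs adj a Q) < c"
  shows "card (nonnbrs adj y A0) \<le> k \<or> card (nonnbrs adj y B) < k + c"
proof (rule ccontr)
  assume neg: "\<not> ?thesis"
  let ?N = "nonnbrs adj y A0" and ?N' = "nonnbrs adj y B"
  have finQ: "finite Q" using assms(3) finite_V finite_subset by blast
  have finN': "finite ?N'" by (rule finite_subset[OF _ finQ]) (use assms(5) in \<open>auto simp: nonnbrs_def\<close>)
  show False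
  proof (rule bipartite_fan[OF assms(1)])
    show "?N \<subseteq> nonnbrs adj y V" "?N' \<subseteq> nonnbrs adj y V" "?N \<inter> ?N' = {}"
      using assms(2-5) by (auto simp: nonnbrs_def)
    show "k < card ?N" using neg by simp
    show "k < card (nonnbrs adj a ?N')" if a: "a \<in> ?N" for a
    proof -
      have aA: "a \<in> A0" using a by (simp add: nonnbrs_def)
      have "a \<notin> ?N'" using aA assms(4,5) by (auto simp: nonnbrs_def)
      moreover have "card (nbrs adj a ?N') \<le> card (nbrs adj a Q)"
        using assms(5) finQ by (intro card_mono) (auto simp: nbrs_def nonnbrs_def)
      ultimately show ?thesis
        using card_nbrs_nonnbrs[OF finN', of a adj] c[OF aA] neg by linarith
    qed
  qed
qed

text \<open>One vertex below \<open>b + b'\<close> is exactly what the pigeonhole argument needs: if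
  each remaining vertex fits one of the two cores, then \<open>b\<close> of them fit the first or
  \<open>b'\<close> of them the second.\<close>

lemma card_rest:
  assumes "core A Y b" "core A' Y' b'" "(A \<union> Y) \<inter> (A' \<union> Y') = {}"
  shows "card (V - (A \<union> Y) - (A' \<union> Y')) + 1 = b + b'"
proof -
  have "A' \<union> Y' \<subseteq> V - (A \<union> Y)" using coreD(1,2)[OF assms(2)] assms(3) by blast
  moreover have "card (A' \<union> Y') + b' = n"
    using coreD(3,4,5,9)[OF assms(2)] by (simp add: card_Un_disjoint)
  ultimately show ?thesis
    using card_outside[OF assms(1)] finite_V coreD(3,4)[OF assms(2)]
      card_mono[of "V - (A \<union> Y)" "A' \<union> Y'"] by (simp add: card_Diff_subset)
qed

section \<open>Excluding balanced leaves, big stars and degree-two slots\<close>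

lemma no_spread_leaves:
  assumes X: "X \<subseteq> leaves" "card X = k" "\<And>p. 2 * card {x \<in> X. parent x = p} \<le> k + 1"
  shows False
proof -
  obtain A Y b where c: "core A Y b" using initial_core by blast
  note core = coreD[OF c]
  \<comment> \<open>Only \<open>b\<close> or \<open>b'\<close> leaves get attached, and any subset
    of \<open>X\<close> inherits the balance.\<close>
  have sub: "\<exists>Xb\<subseteq>leaves. card Xb = d \<and> (\<forall>p. 2 * card {x \<in> Xb. parent x = p} \<le> k + 1)" if d: "d \<le> k" for d
  proof -
    obtain Xb where Xb: "Xb \<subseteq> X" "card Xb = d" "finite Xb"
      using obtain_subset_with_card_n[of d X] d X(2) by metis
    have "finite X" using X(1) finite_leaves finite_subset by blast
    then have "2 * card {x \<in> Xb. parent x = p} \<le> k + 1" for p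
      using card_mono[of "{x \<in> X. parent x = p}" "{x \<in> Xb. parent x = p}"] Xb(1) X(3)[of p] by fastforce
    then show ?thesis using Xb X(1) by blast
  qed
  obtain Xb where Xb: "Xb \<subseteq> leaves" "card Xb = b" "\<And>p. 2 * card {x \<in> Xb. parent x = p} \<le> k + 1"
    using sub[OF core(12)] by blast
  obtain A0 Q p where bn: "A0 \<subseteq> A" "Q \<subseteq> V - (A \<union> Y)" "p \<in> parent ` Xb"
    "card A + card {x \<in> Xb. parent x = p} \<le> card A0 + b"
    "n + card {x \<in> Xb. parent x = p} \<le> card Q + 1"
    "\<And>a. a \<in> A0 \<Longrightarrow> card (nbrs adj a Q) < card {x \<in> Xb. parent x = p}"
    using bottleneck[OF c Xb(1,2)] by blast
  \<comment> \<open>The size of the star at which the attachment gets stuck; by balance it is at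
    most half of \<open>k + 1\<close>.\<close>
  define c0 where "c0 = card {x \<in> Xb. parent x = p}"
  have finXb: "finite Xb" using Xb(1) finite_leaves finite_subset by blast
  have "{x \<in> Xb. parent x = p} \<noteq> {}" using bn(3) by blast
  then have c0: "0 < c0" "2 * c0 \<le> k + 1" using finXb Xb(3)[of p] by (simp_all add: c0_def card_gt_0_iff)
  note bn' = bn(4-6)[folded c0_def]
  have A0big: "n + b + c0 \<le> card A0 + 3 * k" using bn'(1) core(11) by linarith
  have "card A0 \<noteq> 0" using A0big n_ge k_sq c0 by linarith
  then obtain a where a: "a \<in> A0" by fastforce
  have A0V: "A0 \<subseteq> V" "Q \<subseteq> V" "A0 \<inter> Q = {}" using bn(1,2) core(1) by blast+
  obtain A' Y' b' where c': "core A' Y' b'" and Q': "A' \<union> Y' \<subseteq> Q"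
    using second_core[of a Q c0] a A0V bn'(2,3) by blast
  note core' = coreD[OF c']
  define R where "R = V - (A \<union> Y) - (A' \<union> Y')"
  have cR: "card R + 1 = b + b'"
    unfolding R_def using card_rest[OF c c'] Q' bn(2) by blast
  let ?R1 = "{y \<in> R. card (nonnbrs adj y A0) \<le> k}" and ?R2 = "{y \<in> R. card (nonnbrs adj y A') < k + c0}"
  have finR: "finite R" using finite_V by (simp add: R_def)
  \<comment> \<open>A remaining vertex with many non-neighbours in both \<open>A0\<close> and
    \<open>A'\<close> would be the centre of a fan.\<close>
  have "R \<subseteq> ?R1 \<union> ?R2"
    using few_nonnbrs_dichotomy[OF _ A0V, of _ A' c0] Q' bn'(3) by (fastforce simp: R_def)
  then have "card R \<le> card ?R1 + card ?R2"
    using order_trans[OF card_mono[of "?R1 \<union> ?R2" R] card_Un_le[of ?R1 ?R2]] finR by simp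
  then consider "b \<le> card ?R1" | "b' \<le> card ?R2" using cR by linarith
  then show False
  proof cases
    case 1
    show False
    proof (rule attach_stars[OF c Xb(1,2) bn(1) _ 1])
      show "?R1 \<subseteq> V - (A \<union> Y)" by (auto simp: R_def)
      fix q
      let ?c = "card {x \<in> Xb. parent x = q}"
      \<comment> \<open>The lower bound on \<open>n\<close> is used in full here:
        \<open>?c * (k - 1)\<close> may reach \<open>(k - 1) * (k - 1)\<close>, and strictness comes
        only from \<open>0 < c0\<close>.\<close>
      have "?c \<le> k - 1" using Xb(3)[of q] k_ge by linarith
      then have "?c * (k - 1) \<le> (k - 1) * (k - 1)" by (rule mult_right_mono) simp
      moreover have "?c * k = ?c * (k - 1) + ?c" "(k - 1) * (k - 1) + 2 * k = k * k + 1"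
        using k_ge by (cases k; simp)+
      ultimately have "?c * k + 2 * k \<le> k * k + 1 + ?c" by linarith
      then show "?c * k + b < card A0 + ?c" using A0big n_ge c0(1) by linarith
    qed simp
  next
    case 2
    obtain Xc where Xc: "Xc \<subseteq> leaves" "card Xc = b'" "\<And>p. 2 * card {x \<in> Xc. parent x = p} \<le> k + 1"
      using sub[OF core'(12)] by blast
    show False
    proof (rule attach_stars[OF c' Xc(1,2) subset_refl _ 2])
      show "?R2 \<subseteq> V - (A' \<union> Y')" by (auto simp: R_def)
      show "card (nonnbrs adj y A') \<le> k + c0 - 1" if "y \<in> ?R2" for y
      proof -
        have "card (nonnbrs adj y A') < k + c0" using that by blast
        then show ?thesis by linarith
      qed
      fix q
      let ?c = "card {x \<in> Xc. parent x = q}"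
      \<comment> \<open>Balance bounds both factors, through \<open>2 * ?c \<le> k + 1\<close> and
        \<open>2 * c0 \<le> k + 1\<close>, and keeps \<open>?c * (k + c0 - 2)\<close> below three
        quarters of \<open>k * k\<close>.\<close>
      have "(2 * ?c) * (2 * (k + c0 - 2)) \<le> (k + 1) * (3 * k - 3)"
        using Xc(3)[of q] c0 k_ge by (intro mult_mono) auto
      moreover have "(k + 1) * (3 * k - 3) + 3 = 3 * (k * k)"
        using k_ge by (cases k) (simp_all add: algebra_simps)
      moreover have "?c * (k + c0 - 1) = ?c * (k + c0 - 2) + ?c"
      proof -
        have "k + c0 - 1 = Suc (k + c0 - 2)" using k_ge by simp
        then show ?thesis by simp
      qed
      moreover have "(2 * ?c) * (2 * (k + c0 - 2)) = 4 * (?c * (k + c0 - 2))" by simp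
      ultimately have "4 * (?c * (k + c0 - 1)) + 3 \<le> 3 * (k * k) + 4 * ?c" by linarith
      \<comment> \<open>\<open>n - 3 * k\<close> exceeds three quarters of \<open>k * k\<close>, as
        \<open>8 \<le> k\<close> makes a quarter of \<open>k * k\<close> at least
        \<open>2 * k\<close>.\<close>
      then show "?c * (k + c0 - 1) + b' < card A' + ?c"
        using core'(11) n_ge k_sq by linarith
    qed
  qed
qed


text \<open>A vertex \<open>y\<close> of large degree can host a tree vertex with many leaves: the leaves go last.\<close>
lemma no_hub:
  assumes c: "core A Y b" and u: "u \<in> U" and lam: "k \<le> card {x \<in> leaves. parent x = u}"
    and y: "y \<in> V - (A \<union> Y)" and yV: "n \<le> card (nbrs adj y V) + 1"
    and yA: "n \<le> 2 * card (nbrs adj y A) + k + 1"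
  shows False
proof -
  note core = coreD[OF c]
  define L where "L = {x \<in> leaves. parent x = u}"
  define N where "N = {x \<in> U - L. t u x}"
  have LU: "L \<subseteq> U" by (auto simp: L_def leaves_def)
  have finL: "finite L" "finite N" using LU finite_U finite_subset by (auto simp: N_def)
  have Lt: "t x u" "t u x" if "x \<in> L" for x using leafD(3,4)[of x] that by (auto simp: L_def)
  have Lonly: "z = u" if "x \<in> L" "z \<in> U" "t x z" for x z using leafD(5)[of x z] that by (auto simp: L_def)
  have uL: "u \<notin> L"
  proof
    assume "u \<in> L"
    then show False using Lt(1)[of u] t_col by blast
  qed
  have uN: "u \<notin> N" using t_col by (auto simp: N_def)
  have degu: "deg u = card L + card N"
  proof -
    have "{z \<in> U. t u z} = L \<union> N" using LU Lt(2) by (auto simp: N_def)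
    moreover have "card (L \<union> N) = card L + card N" using finL by (intro card_Un_disjoint) (auto simp: N_def)
    ultimately show ?thesis by (simp add: deg_def)
  qed
  \<comment> \<open>A leaf adjacent to \<open>u\<close> belongs to \<open>L\<close>, so the other
    neighbours of \<open>u\<close> are not leaves.\<close>
  have degN: "2 \<le> deg w" if "w \<in> N" for w
  proof -
    have w: "w \<in> U" "w \<notin> L" "t w u" using that t_sym by (auto simp: N_def)
    have "w \<notin> leaves"
    proof
      assume "w \<in> leaves"
      then have "u = parent w" using leafD(5)[of w u] u w(3) by blast
      then show False using w(2) \<open>w \<in> leaves\<close> by (simp add: L_def)
    qed
    then show ?thesis using degree_pos[OF w(1)] w(1) by (simp add: leaves_def deg_def)
  qed
  let ?R = "U - insert u (L \<union> N)"
  have NU: "insert u (L \<union> N) \<subseteq> U" using LU u by (auto simp: N_def)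
  have cI: "card (insert u (L \<union> N)) = Suc (card L + card N)"
  proof -
    have "card (L \<union> N) = card L + card N" using finL by (intro card_Un_disjoint) (auto simp: N_def)
    then show ?thesis using finL uL uN by simp
  qed
  have cR: "card ?R + Suc (card L + card N) = n"
    using NU cI card_U finL finite_U card_mono[OF finite_U NU] by (simp add: card_Diff_subset)
  have "sum deg U = sum deg ?R + sum deg (insert u (L \<union> N))"
    using NU finite_U by (rule sum.subset_diff)
  also have "sum deg (insert u (L \<union> N)) = deg u + (sum deg L + sum deg N)"
  proof -
    have "sum deg (L \<union> N) = sum deg L + sum deg N"
      using finL by (intro sum.union_disjoint) (auto simp: N_def)
    then show ?thesis using finL uL uN by simp
  qed
  finally have sU: "sum deg U = sum deg ?R + (deg u + (sum deg L + sum deg N))" .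
  have s1: "card ?R \<le> sum deg ?R"
  proof -
    have "(\<Sum>x\<in>?R. 1) \<le> sum deg ?R"
      using degree_pos by (intro sum_mono) (auto simp: deg_def Suc_le_eq)
    then show ?thesis by simp
  qed
  have s2: "sum deg L = card L" by (simp add: L_def leaves_def)
  have s3: "2 * card N \<le> sum deg N"
  proof -
    have "(\<Sum>x\<in>N. 2) \<le> sum deg N" using degN by (intro sum_mono) auto
    then show ?thesis by simp
  qed
  have "sum deg U + 2 = 2 * n" using degree_sum card_U by (simp add: deg_def)
  \<comment> \<open>This bounds \<open>N\<close> well enough for it to fit into the neighbours of
    \<open>y\<close> in \<open>A\<close>.\<close>
  then have r: "2 * card N + card L + 1 \<le> n" using sU s1 s2 s3 degu cR by linarith
  have kL: "k \<le> card L" using lam by (simp add: L_def)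
  have "card N \<le> card (nbrs adj y A)" using r kL yA by linarith
  then obtain f0 where f0: "inj_on f0 N" "f0 ` N \<subseteq> nbrs adj y A"
    using card_le_inj[of N "nbrs adj y A"] finL core(3) by (auto simp: nbrs_def)
  define f where "f x = (if x = u then y else f0 x)" for x
  have fu: "f u = y" by (simp add: f_def)
  have fN: "f x = f0 x" "f x \<in> A" "adj y (f x)" if "x \<in> N" for x
    using that uN f0(2) by (auto simp: f_def nbrs_def)
  have fim: "f ` insert u N = insert y (f ` N)" "f ` N = f0 ` N" using fu fN(1) by auto
  have fNA: "f ` N \<subseteq> A" using fN(2) by blast
  have tN: "t u x" if "x \<in> N" for x using that by (simp add: N_def)
  \<comment> \<open>First embed the tree without \<open>L\<close>, with \<open>u\<close> at
    \<open>y\<close> and the other neighbours of \<open>u\<close> in \<open>A\<close>; omitting at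
    least \<open>k\<close> leaves makes up for the defect \<open>b\<close>.\<close>
  have "\<exists>g. inj_on g (U - L) \<and> g ` (U - L) \<subseteq> V \<and> (\<forall>x\<in>insert u N. g x = f x) \<and>
    (\<forall>x\<in>U - L. \<forall>z\<in>U - L. t x z \<longrightarrow> adj (g x) (g z))"
  proof (rule extend_embedding[OF c])
    show "insert u N \<subseteq> U - L" using u uL by (auto simp: N_def)
    have "inj_on f N" using f0(1) inj_on_cong[of N f f0] fN(1) by blast
    moreover have "y \<notin> f ` N" using fNA y by blast
    ultimately show "inj_on f (insert u N)" using fu uN by simp
    show "f ` insert u N \<subseteq> V" "f ` insert u N \<inter> Y = {}"
      unfolding fim(1) using fNA y core(1,5) by auto
    show "adj (f x) (f z)" if xz: "x \<in> insert u N" "z \<in> insert u N" "t x z" for x z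
    proof -
      have "x = u \<or> z = u"
      proof (rule ccontr)
        assume "\<not> ?thesis"
        then have "x \<in> N" "z \<in> N" using xz by auto
        then show False using t_col[OF tN] t_col[OF tN] t_col[OF xz(3)] by blast
      qed
      moreover have "x \<noteq> z" using t_col[OF xz(3)] by blast
      ultimately show ?thesis using xz fN(3)[of x] fN(3)[of z] fu adj_sym by auto
    qed
    show "f x \<in> A" if "x \<in> insert u N" "z \<in> U - L - insert u N" "t x z" for x z
      using that fN(2)[of x] by (auto simp: N_def)
    have eq: "U - L - insert u N = ?R" by blast
    have cA: "card (A - f ` insert u N) + card N = card A"
    proof -
      have "A - f ` insert u N = A - f ` N" unfolding fim(1) using y by blast
      moreover have "card (f ` N) = card N" using f0(1) fim(2) by (simp add: card_image)
      ultimately show ?thesis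
        using fNA core(3) finL card_mono[OF core(3) fNA] by (simp add: card_Diff_subset)
    qed
    show "card (U - L - insert u N) \<le> card (A - f ` insert u N) + card Y"
      unfolding eq using cA cR core(9,12) kL by linarith
    show "card (U - L - insert u N) \<le> 2 * card (A - f ` insert u N)"
      unfolding eq using cA cR core(11,12) kL r n_ge k_sq by linarith
  qed blast
  then obtain g where g: "inj_on g (U - L)" "g ` (U - L) \<subseteq> V" "g u = y"
    "\<And>x z. x \<in> U - L \<Longrightarrow> z \<in> U - L \<Longrightarrow> t x z \<Longrightarrow> adj (g x) (g z)"
    using fu by auto
  \<comment> \<open>The partial tree has \<open>n - 1 - card L\<close> vertices besides
    \<open>u\<close>, so at least \<open>card L\<close> of the \<open>n - 1\<close> or more
    neighbours of \<open>y\<close> are still free.\<close>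
  let ?F = "nbrs adj y V - g ` (U - L - {u})"
  have uUL: "u \<in> U - L" using u uL by blast
  have "card (g ` (U - L - {u})) \<le> card (U - L - {u})" using finite_U by (simp add: card_image_le)
  moreover have "card (U - L - {u}) + card L + 1 = n"
    using uUL LU finL finite_U card_U card_mono[OF finite_U LU] cR by (simp add: card_Diff_subset)
  moreover have "card (nbrs adj y V) - card (g ` (U - L - {u})) \<le> card ?F"
    using finite_U by (intro diff_card_le_card_Diff) simp
  ultimately have "card L \<le> card ?F" using yV by linarith
  moreover have finF: "finite ?F" using finite_V by (simp add: nbrs_def)
  ultimately obtain h where h: "inj_on h L" "h ` L \<subseteq> ?F" using card_le_inj[OF finL(1) finF] by blast
  define e where "e x = (if x \<in> L then h x else g x)" for x
  have eL: "e x = h x" "e x \<in> ?F" if "x \<in> L" for x using that h(2) by (auto simp: e_def)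
  have eU: "e x = g x" if "x \<in> U - L" for x using that by (simp add: e_def)
  have "inj_on e (L \<union> (U - L))"
  proof (rule inj_on_UnI)
    show "inj_on e L" using h(1) inj_on_cong[of L e h] eL(1) by blast
    show "inj_on e (U - L)" using g(1) inj_on_cong[of "U - L" e g] eU by blast
    have "e ` (U - L) = insert y (g ` (U - L - {u}))"
      using eU g(3) uUL by (auto simp: image_iff)
    moreover have "e ` L \<subseteq> ?F" using eL(2) by (rule image_subsetI)
    moreover have "y \<notin> ?F" by (simp add: nbrs_def)
    ultimately show "e ` L \<inter> e ` (U - L) = {}" by auto
  qed
  then have "inj_on e U" using LU by (simp add: Un_absorb1)
  moreover have "e ` U \<subseteq> V"
  proof
    fix v assume "v \<in> e ` U"
    then obtain x where "v = e x" "x \<in> U" by blast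
    then show "v \<in> V" using eL(2)[of x] eU[of x] g(2) by (cases "x \<in> L") (auto simp: nbrs_def)
  qed
  moreover have "adj (e x) (e z)" if xz: "x \<in> U" "z \<in> U" "t x z" for x z
  proof -
    have leaf: "adj (e x) (e z)" "adj (e z) (e x)" if "x \<in> L" "z \<in> U" "t x z" for x z
    proof -
      have "z = u" using Lonly that by blast
      then have "e z = y" using eU[OF uUL] g(3) by simp
      moreover have "adj y (e x)" using eL(2)[OF that(1)] by (simp add: nbrs_def)
      ultimately show "adj (e x) (e z)" "adj (e z) (e x)" using adj_sym by auto
    qed
    show ?thesis
    proof (cases "x \<in> L")
      case True
      then show ?thesis using leaf(1) xz by blast
    next
      case xL: False
      show ?thesis
      proof (cases "z \<in> L")
        case True
        then show ?thesis using leaf(2)[of z x] xz t_sym by blast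
      next
        case False
        then show ?thesis using xL xz g(4)[of x z] eU[of x] eU[of z] by auto
      qed
    qed
  qed
  ultimately have "embeds U t V adj" unfolding embeds_def by (intro exI[of _ e]) simp
  then show False using no_embedding by contradiction
qed

text \<open>All attached leaves share the neighbour \<open>u\<close>, so attaching fails at the very
  first star and the bottleneck concerns all of \<open>A\<close> and everything outside the core.
  The two cores thus play symmetric roles, and a vertex fitting neither has few non-neighbours and
  can host \<open>u\<close>.\<close>

lemma no_big_star:
  assumes u: "u \<in> U" and lam: "k \<le> card {x \<in> leaves. parent x = u}"
  shows False
proof -
  have sub: "\<exists>Xb\<subseteq>leaves. card Xb = d \<and> (\<forall>x\<in>Xb. parent x = u)" if d: "d \<le> k" for d
  proof -
    have "d \<le> card {x \<in> leaves. parent x = u}" using d lam by simp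
    then obtain Xb where "Xb \<subseteq> {x \<in> leaves. parent x = u}" "card Xb = d"
      by (rule obtain_subset_with_card_n)
    then show ?thesis by blast
  qed
  have fib: "{x \<in> X. parent x = p} = X" if "p \<in> parent ` X" "\<forall>x\<in>X. parent x = u" for p X
    using that by auto
  have single: "0 < b \<and> (\<forall>a\<in>A. card (nbrs adj a (V - (A \<union> Y))) < b)" if c: "core A Y b" for A Y b
  proof -
    obtain X where X: "X \<subseteq> leaves" "card X = b" "\<forall>x\<in>X. parent x = u"
      using sub[OF coreD(12)[OF c]] by blast
    obtain A0 Q p where bn: "A0 \<subseteq> A" "Q \<subseteq> V - (A \<union> Y)" "p \<in> parent ` X"
      "card A + card {x \<in> X. parent x = p} \<le> card A0 + b"
      "n + card {x \<in> X. parent x = p} \<le> card Q + 1"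
      "\<forall>a\<in>A0. card (nbrs adj a Q) < card {x \<in> X. parent x = p}"
      using bottleneck[OF c X(1,2)] by blast
    have Xp: "{x \<in> X. parent x = p} = X" using fib[OF bn(3) X(3)] .
    have "A0 = A" using bn(1,4) coreD(3)[OF c] X(2) unfolding Xp by (metis add_le_cancel_right card_seteq)
    moreover have "Q = V - (A \<union> Y)"
      using bn(2,5) card_outside[OF c] finite_V X(2) unfolding Xp
      by (metis add_le_cancel_right card_seteq finite_Diff)
    moreover have "finite X" using X(1) finite_leaves finite_subset by blast
    ultimately show ?thesis using bn(3,6) X(2) unfolding Xp by (auto simp: card_gt_0_iff)
  qed
  have finish: False if c: "core A Y b" and W: "W \<subseteq> V - (A \<union> Y)" "b \<le> card W"
    "\<And>y. y \<in> W \<Longrightarrow> card (nonnbrs adj y A) \<le> k" for A Y b W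
  proof -
    obtain X where X: "X \<subseteq> leaves" "card X = b" "\<forall>x\<in>X. parent x = u"
      using sub[OF coreD(12)[OF c]] by blast
    show False
    proof (rule attach_stars[OF c X(1,2) subset_refl W])
      fix p assume p: "p \<in> parent ` X"
      \<comment> \<open>The tight case is \<open>b = k\<close>, where exactly
        \<open>k * k + k < n\<close> is required.\<close>
      have "b * k + 3 * k < n + 2 * b"
      proof (cases "b = k")
        case True
        then show ?thesis using n_ge by simp
      next
        case False
        obtain j where j: "k = b + j" using coreD(12)[OF c] le_Suc_ex by blast
        then have "0 < j" using False by simp
        have "b * k + 3 * k < k * k + k + 1 + 2 * b"
        proof (cases "j = 1")
          case True
          then show ?thesis using j k_ge by (simp add: algebra_simps)
        next
          case False
          then have "(b + 2) * k \<le> k * k" using j \<open>0 < j\<close> by (intro mult_right_mono) auto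
          then show ?thesis using k_ge by (simp add: algebra_simps)
        qed
        then show ?thesis using n_ge by linarith
      qed
      then show "card {x \<in> X. parent x = p} * k + b < card A + card {x \<in> X. parent x = p}"
        using coreD(11)[OF c] X(2) unfolding fib[OF p X(3)] by simp
    qed
  qed
  obtain A Y b where c: "core A Y b" using initial_core by blast
  note core = coreD[OF c]
  let ?Q = "V - (A \<union> Y)"
  have bA: "0 < b" "\<And>a. a \<in> A \<Longrightarrow> card (nbrs adj a ?Q) < b" using single[OF c] by auto
  have "card A \<noteq> 0" using core(11) n_ge k_sq bA(1) by linarith
  then obtain a where a: "a \<in> A" by fastforce
  have "n + b \<le> card ?Q + 1" using card_outside[OF c] by simp
  then obtain A' Y' b' where c': "core A' Y' b'" and Q': "A' \<union> Y' \<subseteq> ?Q"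
    using second_core[of a ?Q b] a bA(2)[OF a] core(1) by blast
  note core' = coreD[OF c']
  let ?Q' = "V - (A' \<union> Y')"
  have bA': "0 < b'" "\<And>a. a \<in> A' \<Longrightarrow> card (nbrs adj a ?Q') < b'" using single[OF c'] by auto
  define R where "R = ?Q - (A' \<union> Y')"
  have cR: "card R + 1 = b + b'"
    unfolding R_def using card_rest[OF c c'] Q' by blast
  have finR: "finite R" using finite_V by (simp add: R_def)
  have AQ: "A \<subseteq> ?Q'" "A' \<subseteq> ?Q" "A \<inter> ?Q = {}" "A' \<inter> ?Q' = {}" using core(1) Q' by blast+
  \<comment> \<open>The dichotomy is applied in both directions; \<open>d2\<close> exchanges the
    roles of the cores.\<close>
  have d1: "card (nonnbrs adj y A) \<le> k \<or> card (nonnbrs adj y A') < k + b" if "y \<in> R" for y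
    using few_nonnbrs_dichotomy[OF _ core(1) Diff_subset AQ(3,2) bA(2)] that by (simp add: R_def)
  have d2: "card (nonnbrs adj y A') \<le> k \<or> card (nonnbrs adj y A) < k + b'" if "y \<in> R" for y
    using few_nonnbrs_dichotomy[OF _ core'(1) Diff_subset AQ(4,1) bA'(2)] that by (simp add: R_def)
  let ?R1 = "{y \<in> R. card (nonnbrs adj y A) \<le> k}" and ?R2 = "{y \<in> R. card (nonnbrs adj y A') \<le> k}"
  have "card ?R1 < b"
  proof (rule ccontr)
    assume "\<not> ?thesis"
    then show False by (intro finish[OF c, of ?R1]) (auto simp: R_def)
  qed
  moreover have "card ?R2 < b'"
  proof (rule ccontr)
    assume "\<not> ?thesis"
    then show False by (intro finish[OF c', of ?R2]) (auto simp: R_def)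
  qed
  \<comment> \<open>Fewer than \<open>b\<close> vertices fit the first core and fewer than
    \<open>b'\<close> the second, so some \<open>y\<close> among the \<open>b + b' - 1\<close> fits
    neither.\<close>
  ultimately have "card (?R1 \<union> ?R2) < card R" using card_Un_le[of ?R1 ?R2] cR by linarith
  then have "\<not> R \<subseteq> ?R1 \<union> ?R2" using card_mono[of "?R1 \<union> ?R2" R] finR by fastforce
  then obtain y where "y \<in> R" "y \<notin> ?R1 \<union> ?R2" by blast
  then have y: "y \<in> R" "k < card (nonnbrs adj y A)" "k < card (nonnbrs adj y A')"
    by (simp_all add: not_le)
  have h: "card (nonnbrs adj y A) < k + b'" "card (nonnbrs adj y A') < k + b"
    using d1[OF y(1)] d2[OF y(1)] y(2,3) by auto
  have yV: "y \<in> V" "y \<notin> A" "y \<notin> Y" "y \<notin> A'" "y \<notin> Y'" using y(1) by (auto simp: R_def)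
  \<comment> \<open>Summing the bounds for the five pieces gives fewer than \<open>8 * k\<close>
    non-neighbours, and \<open>8 * k \<le> k * k\<close> then yields degree at least
    \<open>n - 1\<close>.\<close>
  have "nonnbrs adj y V \<subseteq> nonnbrs adj y A \<union> (Y \<union> (nonnbrs adj y A' \<union> (Y' \<union> (R - {y}))))"
    by (auto simp: nonnbrs_def R_def)
  then have "card (nonnbrs adj y V) \<le>
      card (nonnbrs adj y A \<union> (Y \<union> (nonnbrs adj y A' \<union> (Y' \<union> (R - {y})))))"
    using core(3,4) core'(3,4) finR by (intro card_mono) (auto simp: nonnbrs_def)
  also have "\<dots> \<le> card (nonnbrs adj y A) + (card Y + (card (nonnbrs adj y A') + (card Y' + card (R - {y}))))"
    by (intro order_trans[OF card_Un_le] add_mono order_refl)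
  finally have "card (nonnbrs adj y V) + 4 + b + b' \<le> 8 * k"
    using h core(10) core'(10) cR card_Suc_Diff1[OF finR y(1)] by linarith
  moreover have "card (nbrs adj y V) + card (nonnbrs adj y V) = card (V - {y})"
  proof -
    have "nbrs adj y (V - {y}) = nbrs adj y V" "nonnbrs adj y (V - {y}) = nonnbrs adj y V"
      by (auto simp: nbrs_def nonnbrs_def)
    then show ?thesis using card_nbrs_nonnbrs[of "V - {y}" y adj] finite_V by simp
  qed
  moreover have "card (V - {y}) + 2 = 2 * n"
    using yV(1) finite_V card_V card_Suc_Diff1[of V y] by linarith
  ultimately have "n \<le> card (nbrs adj y V) + 1" using n_ge k_sq by linarith
  moreover have "n \<le> 2 * card (nbrs adj y A) + k + 1"
    using card_nbrs_nonnbrs[OF core(3) yV(2), of adj] h(1) core(11) core'(12) y(2) n_ge k_sq h(2) y(3) by linarith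
  ultimately show False
    using no_hub[OF c u lam] yV by blast
qed

text \<open>If cherries cannot be attached, outside vertices have at most one neighbour in most of
  \<open>A\<close>; \<open>n\<close> of them form \<open>Q\<close>. Without fans centred in
  \<open>A\<close>, there is a second core inside \<open>Q\<close>; without fans centred in
  \<open>Q\<close>, every vertex of \<open>Q\<close> has few non-neighbours in \<open>Q\<close>. But
  failing to attach cherries to the second core yields a vertex of \<open>Q\<close> with many of
  them.\<close>

lemma no_slots:
  assumes X: "X \<subseteq> U" "card X = k" "\<forall>x\<in>X. deg x = 2" "\<forall>x\<in>X. \<forall>y\<in>X. \<not> t x y"
    "\<forall>x\<in>X. \<forall>y\<in>X. x \<noteq> y \<longrightarrow> {z \<in> U. t x z} \<inter> {z \<in> U. t y z} = {}"
  shows False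
proof -
  have "\<exists>l r. {z \<in> U. t x z} = {l, r} \<and> l \<noteq> r" if "x \<in> X" for x
    using X(3) that by (auto simp: deg_def card_2_iff)
  then obtain l r where lr: "\<And>x. x \<in> X \<Longrightarrow> {z \<in> U. t x z} = {l x, r x}" "\<And>x. x \<in> X \<Longrightarrow> l x \<noteq> r x"
    by metis
  have sep: "{l x, r x} \<inter> {l y, r y} = {}" if "x \<in> X" "y \<in> X" "x \<noteq> y" for x y
    using X(5) lr(1)[OF that(1)] lr(1)[OF that(2)] that by metis
  \<comment> \<open>No core admits enough cherries, so the second alternative of
    \<open>cherry_system\<close> always holds.\<close>
  have cherry: "\<exists>A1 W1. A1 \<subseteq> A \<and> W1 \<subseteq> W \<and> finite W1 \<and> card W1 < b \<and> card A1 + 2 \<le> 2 * b \<and>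
      (\<forall>y\<in>W - W1. card {a \<in> A - A1. adj y a} \<le> 1)"
    if c: "core A Y b" and W: "W \<subseteq> V - (A \<union> Y)" for A Y b W
  proof -
    obtain Z where Z: "Z \<subseteq> X" "card Z = b" "finite Z"
      using obtain_subset_with_card_n[of b X] coreD(12)[OF c] X(2) by metis
    have "\<not> (\<exists>g p q. inj_on g Z \<and> g ` Z \<subseteq> W \<and> inj_on p Z \<and> inj_on q Z \<and> p ` Z \<inter> q ` Z = {} \<and>
        p ` Z \<subseteq> A \<and> q ` Z \<subseteq> A \<and> (\<forall>x\<in>Z. adj (g x) (p x) \<and> adj (g x) (q x)))"
    proof
      assume "\<exists>g p q. inj_on g Z \<and> g ` Z \<subseteq> W \<and> inj_on p Z \<and> inj_on q Z \<and> p ` Z \<inter> q ` Z = {} \<and>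
        p ` Z \<subseteq> A \<and> q ` Z \<subseteq> A \<and> (\<forall>x\<in>Z. adj (g x) (p x) \<and> adj (g x) (q x))"
      then obtain g p q where g: "inj_on g Z" "g ` Z \<subseteq> W" "inj_on p Z" "inj_on q Z" "p ` Z \<inter> q ` Z = {}"
        "p ` Z \<subseteq> A" "q ` Z \<subseteq> A" "\<And>x. x \<in> Z \<Longrightarrow> adj (g x) (p x) \<and> adj (g x) (q x)" by auto
      show False
      proof (rule cherry_embedding[OF c _ Z(2) _ _ _ _ _ g(1) _ g(3-8)])
        show "Z \<subseteq> U" using Z(1) X(1) by blast
        show "\<not> t x y" if "x \<in> Z" "y \<in> Z" for x y using X(4) Z(1) that by blast
        show "{y \<in> U. t x y} = {l x, r x}" if "x \<in> Z" for x using lr(1) Z(1) that by blast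
        show "inj_on l Z" "inj_on r Z" using sep Z(1) by (fastforce intro!: inj_onI)+
        show "l ` Z \<inter> r ` Z = {}"
        proof (rule ccontr)
          assume "l ` Z \<inter> r ` Z \<noteq> {}"
          then obtain x y where xy: "x \<in> X" "y \<in> X" "l x = r y" using Z(1) by blast
          then show False using sep[OF xy(1,2)] lr(2)[OF xy(1)] by (cases "x = y") auto
        qed
        show "g ` Z \<subseteq> V - (A \<union> Y)" using g(2) W by blast
      qed
    qed
    then show ?thesis using cherry_system[OF Z(3) coreD(3)[OF c], of W adj] unfolding Z(2) by blast
  qed
  obtain A Y b where c: "core A Y b" using initial_core by blast
  note core = coreD[OF c]
  let ?W = "V - (A \<union> Y)"
  obtain A1 W1 where *: "A1 \<subseteq> A" "W1 \<subseteq> ?W" "finite W1" "card W1 < b" "card A1 + 2 \<le> 2 * b"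
    "\<And>y. y \<in> ?W - W1 \<Longrightarrow> card {a \<in> A - A1. adj y a} \<le> 1"
    using cherry[OF c subset_refl] by blast
  define A0 where "A0 = A - A1"
  have finA1: "finite A1" using *(1) core(3) finite_subset by blast
  have cA0: "n + 2 \<le> card A0 + 3 * k"
    using *(1,5) finA1 core(11) card_Diff_subset[OF finA1 *(1)] unfolding A0_def by linarith
  have finA0: "finite A0" and A0V: "A0 \<subseteq> V" using core(1,3) by (auto simp: A0_def)
  have "n \<le> card (?W - W1)"
    using card_Diff_subset[OF *(3,2)] *(4) card_outside[OF c] by linarith
  then obtain Q where Q: "Q \<subseteq> ?W - W1" "card Q = n" "finite Q" by (rule obtain_subset_with_card_n)
  have QV: "Q \<subseteq> V" "Q \<inter> A0 = {}" using Q(1) by (auto simp: A0_def)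
  have one: "card (nbrs adj y A0) \<le> 1" if "y \<in> Q" for y
  proof -
    have "nbrs adj y A0 = {a \<in> A - A1. adj y a}" using that QV(2) by (auto simp: nbrs_def A0_def)
    then show ?thesis using *(6)[of y] that Q(1) by auto
  qed
  have "card M \<le> k" if M: "matching (nonedges adj Q) M" for M
  proof (rule ccontr)
    assume "\<not> card M \<le> k"
    then have "Suc k \<le> card M" by simp
    then obtain M' where M': "M' \<subseteq> M" "card M' = Suc k" "finite M'" by (rule obtain_subset_with_card_n)
    have mat: "matching (nonedges adj Q) M'"
      using M M'(1) unfolding matching_def by (meson order_trans pairwise_subset)
    have e2: "card e = 2" "e \<subseteq> Q" if "e \<in> M'" for e
      using that mat by (auto simp: matching_def nonedges_def subset_iff)
    have "card (\<Union>M') \<le> sum card M'" by (rule card_Union_le_sum_card)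
    also have "\<dots> = 2 * Suc k" using e2 M'(2) by simp
    finally have cU: "card (\<Union>M') \<le> 2 * Suc k" .
    have MQ: "\<Union>M' \<subseteq> Q" using e2(2) by blast
    \<comment> \<open>The at most \<open>2 * k + 2\<close> vertices of \<open>M'\<close> together
      have at most that many neighbours in \<open>A0\<close>, so some \<open>a\<close> in
      \<open>A0\<close> misses them all and is the centre of a fan.\<close>
    have "card (\<Union>y\<in>\<Union>M'. nbrs adj y A0) \<le> (\<Sum>y\<in>\<Union>M'. card (nbrs adj y A0))"
      using MQ Q(3) finite_subset by (intro card_UN_le) blast
    also have "\<dots> \<le> (\<Sum>y\<in>\<Union>M'. 1)" using one MQ by (intro sum_mono) blast
    finally have "card (\<Union>y\<in>\<Union>M'. nbrs adj y A0) \<le> 2 * k + 2" using cU by simp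
    then have "card (\<Union>y\<in>\<Union>M'. nbrs adj y A0) < card A0" using cA0 n_ge k_sq k_ge by linarith
    moreover have "finite (\<Union>y\<in>\<Union>M'. nbrs adj y A0)"
      by (rule finite_subset[OF _ finA0]) (auto simp: nbrs_def)
    ultimately have "\<not> A0 \<subseteq> (\<Union>y\<in>\<Union>M'. nbrs adj y A0)" using card_mono by (metis not_le)
    then obtain a where a: "a \<in> A0" "a \<notin> (\<Union>y\<in>\<Union>M'. nbrs adj y A0)" by blast
    have "\<Union>M' \<subseteq> nonnbrs adj a V"
    proof
      fix y assume y: "y \<in> \<Union>M'"
      then have "y \<in> Q" using MQ by blast
      moreover have "\<not> adj y a" if "a \<noteq> y" using a y that by (auto simp: nbrs_def)
      ultimately show "y \<in> nonnbrs adj a V"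
        using QV a(1) adj_sym by (auto simp: nonnbrs_def)
    qed
    then have "M' \<subseteq> nonedges adj (nonnbrs adj a V)"
    proof (intro subsetI)
      fix e assume sub: "\<Union>M' \<subseteq> nonnbrs adj a V" and e: "e \<in> M'"
      then have "e \<in> nonedges adj Q" using mat by (auto simp: matching_def)
      then obtain x z where "e = {x, z}" "x \<noteq> z" "\<not> adj x z" unfolding nonedges_def by blast
      then show "e \<in> nonedges adj (nonnbrs adj a V)" using sub e by (auto intro!: nonedgesI)
    qed
    then have "matching (nonedges adj (nonnbrs adj a V)) M'" using mat by (simp add: matching_def)
    then show False using no_fan[of a M'] a(1) A0V M'(2) by auto
  qed
  then obtain A' Y' b' where c': "core A' Y' b'" and Q': "A' \<union> Y' \<subseteq> Q"
    using core_exists[OF QV(1) Q(2)] by blast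
  note core' = coreD[OF c']
  \<comment> \<open>More than \<open>k\<close> non-neighbours of \<open>x\<close> in
    \<open>Q\<close> could be matched into \<open>A0\<close>, where \<open>x\<close> and each of
    them have at most one neighbour; this would be a fan with centre \<open>x\<close>.\<close>
  have low: "card (nonnbrs adj x Q) \<le> k" if x: "x \<in> Q" for x
  proof (rule ccontr)
    assume neg: "\<not> ?thesis"
    have cx: "card A0 \<le> card (nonnbrs adj x A0) + 1"
      using card_nbrs_nonnbrs[OF finA0, of x adj] one[OF x] x QV(2) by fastforce
    show False
    proof (rule bipartite_fan[of x "nonnbrs adj x Q" "nonnbrs adj x A0"])
      show "x \<in> V" using x QV by blast
      show "nonnbrs adj x Q \<subseteq> nonnbrs adj x V" "nonnbrs adj x A0 \<subseteq> nonnbrs adj x V"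
        "nonnbrs adj x Q \<inter> nonnbrs adj x A0 = {}"
        using QV A0V by (auto simp: nonnbrs_def)
      show "k < card (nonnbrs adj x Q)" using neg by simp
      fix q assume q: "q \<in> nonnbrs adj x Q"
      have qQ: "q \<in> Q" using q by (simp add: nonnbrs_def)
      let ?N = "nonnbrs adj x A0"
      have "card (nbrs adj q ?N) \<le> card (nbrs adj q A0)"
        using finA0 by (intro card_mono) (auto simp: nbrs_def nonnbrs_def)
      moreover have "card (nbrs adj q ?N) + card (nonnbrs adj q ?N) = card ?N"
        using finA0 qQ QV(2) by (intro card_nbrs_nonnbrs) (auto simp: nonnbrs_def)
      ultimately show "k < card (nonnbrs adj q ?N)"
        using one[OF qQ] cx cA0 n_ge k_sq k_ge by linarith
    qed
  qed
  let ?O = "Q - (A' \<union> Y')"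
  have "?O \<subseteq> V - (A' \<union> Y')" using QV by blast
  from cherry[OF c' this] obtain A2 W2 where **: "A2 \<subseteq> A'" "W2 \<subseteq> ?O" "finite W2" "card W2 < b'" "card A2 + 2 \<le> 2 * b'"
    "\<And>y. y \<in> ?O - W2 \<Longrightarrow> card {a \<in> A' - A2. adj y a} \<le> 1"
    by blast
  have "card (A' \<union> Y') + b' = n" using core' by (simp add: card_Un_disjoint)
  moreover have "card ?O + card (A' \<union> Y') = n"
    using Q' Q(2,3) core'(3,4) card_mono[OF Q(3) Q'] by (simp add: card_Diff_subset)
  \<comment> \<open>Exactly \<open>b'\<close> vertices of \<open>Q\<close> lie outside the second
    core, so one of them avoids \<open>W2\<close>.\<close>
  ultimately have "card W2 < card ?O" using **(4) by linarith
  then obtain y where y: "y \<in> ?O" "y \<notin> W2" using **(2,3) by (metis card_mono not_le subsetI)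
  have "A' \<subseteq> A2 \<union> ({a \<in> A' - A2. adj y a} \<union> nonnbrs adj y Q)"
    using Q' y(1) by (auto simp: nonnbrs_def)
  then have "card A' \<le> card (A2 \<union> ({a \<in> A' - A2. adj y a} \<union> nonnbrs adj y Q))"
    using **(1) core'(3) Q(3) finite_subset by (intro card_mono) (auto simp: nonnbrs_def)
  also have "\<dots> \<le> card A2 + (card {a \<in> A' - A2. adj y a} + card (nonnbrs adj y Q))"
    by (intro order_trans[OF card_Un_le] add_mono order_refl)
  also have "\<dots> \<le> card A2 + (1 + k)" using **(6)[of y] low[of y] y by (intro add_mono) auto
  \<comment> \<open>The bounds would give \<open>n < 4 * k\<close>, contrary to
    \<open>n_ge\<close>.\<close>
  finally show False using core'(11) **(5) n_ge k_sq k_ge by linarith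
qed

text \<open>The cases are exhaustive: a star with \<open>k\<close> leaves; no such star but more
  than \<open>3 * k / 2 - 2\<close> leaves; or few leaves, hence many vertices of degree 2.\<close>

lemma embedding_contradiction: False
proof (cases "\<exists>p. k \<le> card {x \<in> leaves. parent x = p}")
  case True
  then obtain p where p: "k \<le> card {x \<in> leaves. parent x = p}" by blast
  then have "{x \<in> leaves. parent x = p} \<noteq> {}" using k_ge by (metis card.empty le_zero_eq not_numeral_le_zero)
  then have "p \<in> U" using leafD(2) by blast
  then show ?thesis using no_big_star p by blast
next
  case False
  then have small: "card {x \<in> leaves. parent x = p} < k" for p by (simp add: not_le)
  show ?thesis
  proof (cases "3 * k < 2 * card leaves + 4")
    case True
    then show ?thesis using obtain_spread_leaves[OF small] no_spread_leaves by blast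
  next
    case False
    then have "2 * card leaves + 4 \<le> 3 * k" by simp
    then show ?thesis using obtain_slots no_slots by blast
  qed
qed

end

section \<open>The Ramsey number\<close>

lemma matching_imp_fan:
  assumes y: "y \<in> V" and M: "matching (nonedges (\<lambda>a b. {a, b} \<in> E) (nonnbrs (\<lambda>a b. {a, b} \<in> E) y V)) M"
    and m: "card M = m" "0 < m"
  shows "contains (complement (V, E)) (fan m)"
proof -
  let ?N = "nonnbrs (\<lambda>a b. {a, b} \<in> E) y V"
  have "finite M" using m card_gt_0_iff by metis
  then obtain e where e: "bij_betw e {1..m} M" using ex_bij_betw_nat_finite_1 m(1) by blast
  define P where "P i a b \<longleftrightarrow> e i = {a, b} \<and> a \<in> ?N \<and> b \<in> ?N \<and> a \<noteq> b \<and> {a, b} \<notin> E" for i a b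
  have "\<exists>a b. P i a b" if "i \<in> {1..m}" for i
    using bij_betwE[OF e] that M unfolding matching_def nonedges_def P_def by blast
  then obtain p q where "\<And>i. i \<in> {1..m} \<Longrightarrow> P i (p i) (q i)" by metis
  then have pq: "\<And>i. i \<in> {1..m} \<Longrightarrow> e i = {p i, q i} \<and> p i \<in> ?N \<and> q i \<in> ?N \<and> p i \<noteq> q i \<and> {p i, q i} \<notin> E"
    unfolding P_def .
  \<comment> \<open>The hub goes to \<open>y\<close>; the fan vertices \<open>2 * i - 1\<close> and
    \<open>2 * i\<close> both have index \<open>i\<close> under \<open>Suc j div 2\<close> and go to
    the two ends of the \<open>i\<close>-th matching edge.\<close>
  define f where "f j = (if j = 0 then y else if even j then q (Suc j div 2) else p (Suc j div 2))" for j
  have idx: "Suc j div 2 \<in> {1..m}" if "j \<in> {1..2 * m}" for j using that by auto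
  have fe: "f j \<in> e (Suc j div 2)" "f j \<in> ?N" if "j \<in> {1..2 * m}" for j
    using pq[OF idx[OF that]] that by (auto simp: f_def)
  have f0: "f 0 = y" by (simp add: f_def)
  \<comment> \<open>Equal images lie in a common matching edge, which fixes the index; the two ends
    of that edge differ, which fixes the parity.\<close>
  have inj1: "i = j" if ij: "i \<in> {1..2 * m}" "j \<in> {1..2 * m}" "f i = f j" for i j
  proof -
    have "\<not> disjnt (e (Suc i div 2)) (e (Suc j div 2))"
      using fe(1)[OF ij(1)] fe(1)[OF ij(2)] ij(3) by (auto simp: disjnt_def)
    then have "e (Suc i div 2) = e (Suc j div 2)"
      using M idx[OF ij(1)] idx[OF ij(2)] bij_betwE[OF e] unfolding matching_def pairwise_def by metis
    then have same: "Suc i div 2 = Suc j div 2"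
      using inj_onD[OF bij_betw_imp_inj_on[OF e]] idx[OF ij(1)] idx[OF ij(2)] by blast
    have "even i = even j"
      using ij same pq[OF idx[OF ij(1)]] by (auto simp: f_def split: if_splits)
    then show ?thesis using same by presburger
  qed
  have Vn: "?N \<subseteq> V" "y \<notin> ?N" by (auto simp: nonnbrs_def)
  have split: "{0..2 * m} = insert 0 {1..2 * m}" by auto
  have "inj_on f {1..2 * m}" using inj1 by (intro inj_onI) blast
  moreover have "f 0 \<notin> f ` {1..2 * m}" using fe(2) Vn(2) f0 by auto
  ultimately have "inj_on f {0..2 * m}" unfolding split by simp
  moreover have "f ` {0..2 * m} \<subseteq> V" unfolding split using fe(2) Vn(1) y f0 by auto
  moreover have "f ` d \<in> all_edges V - E" if d: "d \<in> snd (fan m)" for d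
  proof -
    consider i where "d = {0, i}" "i \<in> {1..2 * m}" | i where "d = {2 * i - 1, 2 * i}" "i \<in> {1..m}"
      using d by (auto simp: fan_def)
    then show ?thesis
    proof cases
      case 1
      then have "f ` d = {y, f i}" "f i \<in> ?N" using f0 fe(2) by auto
      then show ?thesis using y by (auto simp: all_edges_def nonnbrs_def)
    next
      case 2
      have "Suc (2 * i - 1) div 2 = i" "odd (2 * i - 1)" "Suc (2 * i) div 2 = i" "2 * i - 1 \<noteq> 0"
        using 2(2) by auto
      then have "f ` d = {p i, q i}" using 2 by (simp add: f_def)
      then show ?thesis using pq[OF 2(2)] Vn(1) by (auto simp: all_edges_def)
    qed
  qed
  ultimately show ?thesis unfolding contains_def by (intro exI[of _ f]) (simp add: complement_def fan_def)
qed

section \<open>The upper and the lower bound\<close>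

lemma tree_reachable_closed:
  assumes "tree T" "S \<subseteq> fst T" "S \<noteq> {}"
    "\<And>x y. x \<in> S \<Longrightarrow> {x, y} \<in> snd T \<Longrightarrow> y \<in> S"
  shows "S = fst T"
proof -
  obtain s where s: "s \<in> S" using assms(3) by blast
  have "y \<in> S" if y: "y \<in> fst T" for y
  proof -
    have "(\<lambda>x y. {x, y} \<in> snd T)\<^sup>*\<^sup>* s y"
      using assms(1,2) s y by (auto simp: tree_def connected_graph_def)
    then show ?thesis by (induction rule: rtranclp_induct) (use s assms(4) in auto)
  qed
  then show ?thesis using assms(2) by blast
qed

text \<open>A counterexample on \<open>2 * n - 1\<close> vertices would be an instance of
  \<open>tree_free\<close> with \<open>k = m - 1\<close>, and that locale is contradictory.\<close>

lemma ramsey_upper: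
  fixes T :: "'a graph"
  assumes m: "9 \<le> m" and n: "m\<^sup>2 - m + 1 \<le> n" and T: "tree T" "card (fst T) = n"
    and G: "simple_graph ({..<2 * n - 1}, E)"
  shows "contains ({..<2 * n - 1}, E) T \<or> contains (complement ({..<2 * n - 1}, E)) (fan m)"
proof (rule ccontr)
  assume neg: "\<not> ?thesis"
  define V where "V = {..<2 * n - 1}"
  define adj where "adj = (\<lambda>a b. {a, b} \<in> E)"
  define t where "t = (\<lambda>a b. {a, b} \<in> snd T)"
  obtain k where k: "m = Suc k" using m by (cases m) auto
  have nk: "k * k + k + 1 \<le> n" using n unfolding k by (simp add: power2_eq_square)
  have k8: "8 \<le> k" using m k by simp
  have n3: "3 \<le> n" using nk k8 by linarith
  have built: "built (fst T) (snd T)" by (rule tree_built[OF T(1)])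
  obtain col :: "'a \<Rightarrow> bool" where col: "\<forall>x y. {x, y} \<in> snd T \<longrightarrow> col x \<noteq> col y"
    using built_coloring[OF built] by blast
  have mem: "y \<in> fst T" if "{x, y} \<in> snd T" for x y using built_edge_mem(2)[OF built that] .
  have emb: "contains (V, E) T" if em: "embeds (fst T) t V adj"
  proof -
    obtain f where f: "inj_on f (fst T)" "f ` fst T \<subseteq> V"
      "\<And>x y. x \<in> fst T \<Longrightarrow> y \<in> fst T \<Longrightarrow> t x y \<Longrightarrow> adj (f x) (f y)"
      using em by (auto simp: embeds_def)
    have "f ` e \<in> E" if e: "e \<in> snd T" for e
    proof -
      obtain x y where "e = {x, y}" "x \<in> fst T" "y \<in> fst T" using built_edges[OF built e] by blast
      then show ?thesis using f(3)[of x y] e by (simp add: t_def adj_def)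
    qed
    then show ?thesis using f(1,2) unfolding contains_def by (intro exI[of _ f]) simp
  qed
  have nemb: "\<not> embeds (fst T) t V adj" using emb neg by (auto simp: V_def)
  have adj_sym: "adj y x" if "adj x y" for x y using that by (simp add: adj_def insert_commute)
  have "tree_free V adj n k (fst T) t col"
  proof
    show "finite V" "card V + 1 = 2 * n" "k * k + k + 1 \<le> n" "8 \<le> k"
      using n3 nk k8 by (simp_all add: V_def)
    show "adj x y \<Longrightarrow> adj y x" for x y by (rule adj_sym)
    show "card M \<le> k" if "y \<in> V" "matching (nonedges adj (nonnbrs adj y V)) M" for y M
    proof (rule ccontr)
      assume "\<not> card M \<le> k"
      then have "m \<le> card M" using k by simp
      then obtain M' where M': "M' \<subseteq> M" "card M' = m" by (rule obtain_subset_with_card_n)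
      have mat: "matching (nonedges adj (nonnbrs adj y V)) M'"
        using that(2) M'(1) unfolding matching_def by (meson order_trans pairwise_subset)
      have "contains (complement (V, E)) (fan m)"
        using matching_imp_fan[OF that(1) mat[unfolded adj_def] M'(2)] k by simp
      then show False using neg by (simp add: V_def)
    qed
    show "finite (fst T)" by (rule built_finite[OF built])
    show "card (fst T) = n" by (rule T(2))
    show "t x y \<Longrightarrow> t y x" for x y by (simp add: t_def insert_commute)
    show "t x y \<Longrightarrow> col x \<noteq> col y" for x y using col by (simp add: t_def)
    show "(\<Sum>x\<in>fst T. card {y \<in> fst T. t x y}) + 2 = 2 * card (fst T)"
      using built_degree_sum[OF built] by (simp add: t_def)
    show "0 < card {y \<in> fst T. t x y}" if x: "x \<in> fst T" for x
    proof (rule ccontr)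
      assume "\<not> ?thesis"
      then have "{y \<in> fst T. t x y} = {}" using built_finite[OF built] by simp
      then have "{x} = fst T"
        using x mem by (intro tree_reachable_closed[OF T(1)]) (auto simp: t_def)
      then have "card {x} = card (fst T)" by simp
      then show False using T(2) n3 by simp
    qed
    \<comment> \<open>Two adjacent leaves would form a whole component, but the tree has at least 3
      vertices.\<close>
    show "card {z \<in> fst T. t y z} \<noteq> 1"
      if xy: "x \<in> fst T" "y \<in> fst T" "t x y" "card {y \<in> fst T. t x y} = 1" for x y
    proof
      assume y1: "card {z \<in> fst T. t y z} = 1"
      have single: "S = {a}" if "card S = 1" "a \<in> S" for S and a :: 'a
        using that by (metis card_1_singletonE singletonD)
      have yz: "{z \<in> fst T. t y z} = {x}"
        using xy by (intro single[OF y1]) (simp add: t_def insert_commute)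
      have xz: "{z \<in> fst T. t x z} = {y}" using xy by (intro single) simp_all
      have "{x, y} = fst T"
      proof (rule tree_reachable_closed[OF T(1)])
        show "b \<in> {x, y}" if "a \<in> {x, y}" "{a, b} \<in> snd T" for a b
          using that mem[OF that(2)] xz yz unfolding t_def by blast
      qed (use xy in auto)
      moreover have "card {x, y} \<le> 2" by (cases "x = y") auto
      ultimately have "card (fst T) \<le> 2" by simp
      then show False using T(2) n3 by simp
    qed
    show "\<not> embeds (fst T) t V adj" by (rule nemb)
    show "\<exists>v\<in>V. n \<le> card (nonnbrs adj v V)"
    proof (rule ccontr)
      assume no: "\<not> ?thesis"
      \<comment> \<open>If no vertex has \<open>n\<close> non-neighbours, all degrees are at least
        \<open>n - 1\<close> and the greedy embedding succeeds.\<close>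
      have deg: "n - 1 \<le> card {y \<in> V. y \<noteq> x \<and> adj x y}" if x: "x \<in> V" for x
      proof -
        have "nbrs adj x (V - {x}) = {y \<in> V. y \<noteq> x \<and> adj x y}" "nonnbrs adj x (V - {x}) = nonnbrs adj x V"
          by (auto simp: nbrs_def nonnbrs_def)
        moreover have "card (V - {x}) = 2 * n - 2" using x by (simp add: V_def)
        ultimately have "card {y \<in> V. y \<noteq> x \<and> adj x y} + card (nonnbrs adj x V) = 2 * n - 2"
          using card_nbrs_nonnbrs[of "V - {x}" x adj] by (simp add: V_def)
        moreover have "card (nonnbrs adj x V) < n" using no x by (simp add: not_le)
        ultimately show ?thesis by linarith
      qed
      have "0 \<in> V" using n3 by (simp add: V_def)
      then have V: "V \<noteq> {}" "finite V" "card (fst T) \<le> Suc (n - 1)"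
        using T(2) by (blast, simp_all add: V_def)
      obtain f where "inj_on f (fst T)" "f ` fst T \<subseteq> V" "\<forall>x y. {x, y} \<in> snd T \<longrightarrow> adj (f x) (f y)"
        using built_greedy_embedding[OF built V(3,2,1) deg adj_sym] by blast
      then have "embeds (fst T) t V adj" unfolding embeds_def t_def by blast
      then show False using nemb by contradiction
    qed
  qed
  then show False by (rule tree_free.embedding_contradiction)
qed

text \<open>On at most \<open>2 * n - 2\<close> vertices take two disjoint cliques with at most
  \<open>n - 1\<close> vertices each. A connected graph on \<open>n\<close> vertices does not fit,
  and the complement is bipartite and so has no triangle.\<close>

lemma ramsey_lower:
  fixes T :: "'a graph"
  assumes m: "0 < m" and T: "tree T" "card (fst T) = n" and N: "N < 2 * n - 1"
  shows "\<exists>E. simple_graph ({..<N}, E) \<and> \<not> contains ({..<N}, E) T \<and>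
    \<not> contains (complement ({..<N}, E)) (fan m)"
proof -
  define E where "E = {{u, v} | u v. u < N \<and> v < N \<and> u \<noteq> v \<and> (u < n - 1 \<longleftrightarrow> v < n - 1)}"
  have EI: "{u, v} \<in> E \<longleftrightarrow> u < N \<and> v < N \<and> u \<noteq> v \<and> (u < n - 1 \<longleftrightarrow> v < n - 1)" for u v
    unfolding E_def by (auto simp: doubleton_eq_iff)
  have "simple_graph ({..<N}, E)" by (auto simp: simple_graph_def all_edges_def E_def)
  moreover have "\<not> contains ({..<N}, E) T"
  proof
    assume "contains ({..<N}, E) T"
    then obtain f where f: "inj_on f (fst T)" "f ` fst T \<subseteq> {..<N}" "\<And>e. e \<in> snd T \<Longrightarrow> f ` e \<in> E"
      by (auto simp: contains_def)
    have built: "built (fst T) (snd T)" by (rule tree_built[OF T(1)])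
    obtain s where s: "s \<in> fst T" using T(1) by (auto simp: tree_def)
    \<comment> \<open>Edges of \<open>E\<close> never cross between the cliques, so connectedness
      keeps the image of the tree on the side of \<open>f s\<close>.\<close>
    have side: "{x \<in> fst T. f x < n - 1 \<longleftrightarrow> f s < n - 1} = fst T"
    proof (rule tree_reachable_closed[OF T(1)])
      fix x y assume xy: "x \<in> {x \<in> fst T. f x < n - 1 \<longleftrightarrow> f s < n - 1}" "{x, y} \<in> snd T"
      have "{f x, f y} \<in> E" using f(3)[OF xy(2)] by simp
      then show "y \<in> {x \<in> fst T. f x < n - 1 \<longleftrightarrow> f s < n - 1}"
        using xy built_edge_mem(2)[OF built xy(2)] EI by auto
    qed (use s in auto)
    have cf: "card (f ` fst T) = n" using f(1) T(2) by (simp add: card_image)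
    show False
    proof (cases "f s < n - 1")
      case True
      then have "f ` fst T \<subseteq> {..<n - 1}" using side by auto
      then have "n \<le> n - 1" using card_mono[of "{..<n - 1}" "f ` fst T"] cf by simp
      then show False using N by simp
    next
      case False
      then have "f ` fst T \<subseteq> {n - 1..<N}" using side f(2) by force
      then have "n \<le> N - (n - 1)" using card_mono[of "{n - 1..<N}" "f ` fst T"] cf by simp
      then show False using N by simp
    qed
  qed
  moreover have "\<not> contains (complement ({..<N}, E)) (fan m)"
  proof
    assume "contains (complement ({..<N}, E)) (fan m)"
    then obtain f where f: "inj_on f {0..2 * m}" "f ` {0..2 * m} \<subseteq> {..<N}"
      "\<And>e. e \<in> snd (fan m) \<Longrightarrow> f ` e \<notin> E"
      by (auto simp: contains_def complement_def fan_def)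
    \<comment> \<open>One triangle of the fan suffices: two of its three vertices lie on the same
      side and are joined in \<open>E\<close>.\<close>
    have edge: "{0, 1} \<in> snd (fan m)" "{0, 2} \<in> snd (fan m)" "{1, 2} \<in> snd (fan m)"
    proof -
      show "{0, 1} \<in> snd (fan m)" "{0, 2} \<in> snd (fan m)" using m by (auto simp: fan_def)
      have "{1, 2} = {2 * 1 - 1, 2 * (1 :: nat)}" by simp
      moreover have "1 \<le> m" using m by simp
      ultimately show "{1, 2} \<in> snd (fan m)" unfolding fan_def by auto
    qed
    have "f 0 \<noteq> f 1" "f 0 \<noteq> f 2" "f 1 \<noteq> f 2"
      using inj_onD[OF f(1), of 0 1] inj_onD[OF f(1), of 0 2] inj_onD[OF f(1), of 1 2] m by auto
    moreover have "f 0 < N" "f 1 < N" "f 2 < N" using f(2) m by (auto simp: image_subset_iff)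
    moreover have "{f 0, f 1} \<notin> E" "{f 0, f 2} \<notin> E" "{f 1, f 2} \<notin> E"
      using f(3)[OF edge(1)] f(3)[OF edge(2)] f(3)[OF edge(3)] by simp_all
    ultimately show False unfolding EI by blast
  qed
  ultimately show ?thesis by blast
qed

theorem theorem4:
  fixes m n :: nat and T :: "'a graph"
  assumes "m \<ge> 9" and "n \<ge> m^2 - m + 1"
    and "tree T" and "card (fst T) = n"
  shows "ramsey_number T (fan m) = 2*n - 1"
  unfolding ramsey_number_def
proof (rule Least_equality)
  have "0 < 2 * n - 1" using assms(2) by simp
  then show "0 < 2 * n - 1 \<and> (\<forall>E. simple_graph ({..<2 * n - 1}, E) \<longrightarrow>
      contains ({..<2 * n - 1}, E) T \<or> contains (complement ({..<2 * n - 1}, E)) (fan m))"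
    using ramsey_upper[OF assms] by blast
next
  fix N :: nat
  assume N: "0 < N \<and> (\<forall>E. simple_graph ({..<N}, E) \<longrightarrow>
      contains ({..<N}, E) T \<or> contains (complement ({..<N}, E)) (fan m))"
  have "0 < m" using assms(1) by simp
  then show "2 * n - 1 \<le> N" using ramsey_lower[OF _ assms(3,4), of m N] N by (meson not_le)
qed

end
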